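(* Let $L>0$ and $\sigma\ge0$. Let $\mathcal D\subset\mathbb R^d$ be an open set and assume that $|\nabla f(x)|^2\ge2Lf(x)$ for all $x\in\mathcal D$. Moreover, for $n\in\mathbb N_0$, let $\mathbb A_n=\{X_i\in\mathcal D\text{ for all }i=0,\dots,n\}$ and assume that $\mathbb E[|D_{n+1}|^2\mid\mathcal F_n]\le\sigma f(X_n)$ on $\mathbb A_n$. Set $\kappa=\frac{C_L}{L}$ and let $$\mu\in\begin{cases}\bigl[\tfrac1{\sqrt8}(5-\sqrt{9-8\kappa})\sqrt L,\ \tfrac1{\sqrt8}(5+\sqrt{9-8\kappa})\sqrt L\,\bigr],&\text{if }\kappa<\tfrac98,\\[2pt]\bigl\{(2\sqrt\kappa-\sqrt{\kappa-1})\sqrt L\bigr\},&\text{if }\kappa\ge\tfrac98.\end{cases}$$ Then, for every $\varepsilon>0$ there exist $C\ge0$ and $\bar\gamma>0$ such that if $\sup_{n\in\mathbb N}\gamma_n\le\bar\gamma$ it holds that $$\mathbb E[\mathbf 1_{\mathbb A_{n-1}}f(X_n)]\le C\exp(-(m-\varepsilon)t_n)\quad\text{for all }n\in\mathbb N,$$ where $t_n=\sum_{i=1}^n\gamma_i$ and $$m=\begin{cases}\sqrt{2L},&\text{if }\kappa<\tfrac98,\\2(\sqrt\kappa-\sqrt{\kappa-1})\sqrt L,&\text{if }\kappa\ge\tfrac98.\end{cases}$$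
   Context: Setting. $f:\mathbb R^d\to\mathbb R$ is differentiable with $C_L$-Lipschitz continuous gradient for some constant $C_L\ge0$, and $\inf_{x\in\mathbb R^d}f(x)=0$. On a filtered probability space $(\Omega,(\mathcal F_n)_{n\in\mathbb N_0},\mathcal F,\mathbb P)$, $(X_n)_{n\in\mathbb N_0}$ and $(V_n)_{n\in\mathbb N_0}$ are $(\mathcal F_n)$-adapted $\mathbb R^d$-valued processes (momentum stochastic gradient descent, MSGD) satisfying, for all $n\in\mathbb N_0$, $$X_{n+1}=X_n+\gamma_{n+1}V_{n+1},\qquad V_{n+1}=V_n-\gamma_{n+1}\mu V_n-\gamma_{n+1}\nabla f(X_n)+\gamma_{n+1}D_{n+1},$$ where $X_0,V_0\in L^2(\Omega,\mathcal F_0)$, $(\gamma_n)_{n\in\mathbb N}$ is a sequence of strictly positive reals (step-sizes), $\mu>0$ (friction parameter), and $(D_n)_{n\in\mathbb N}$ is a sequence of $L^2$-martingale differences with respect to $(\mathcal F_n)_{n\in\mathbb N_0}$. *)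

theory Defs
  imports "HOL-Probability.Probability"
begin

definition filtered_prob_space :: "'a measure \<Rightarrow> (nat \<Rightarrow> 'a measure) \<Rightarrow> bool" where
  "filtered_prob_space M F \<longleftrightarrow>
     prob_space M \<and> filtration (space M) F \<and> (\<forall>n. subalgebra M (F n))"

definition adapted :: "(nat \<Rightarrow> 'a measure) \<Rightarrow> (nat \<Rightarrow> 'a \<Rightarrow> 'b::topological_space) \<Rightarrow> bool" where
  "adapted F X \<longleftrightarrow> (\<forall>n. X n \<in> borel_measurable (F n))"

definition square_integrable :: "'a measure \<Rightarrow> ('a \<Rightarrow> 'b::euclidean_space) \<Rightarrow> bool" where
  "square_integrable M Y \<longleftrightarrow>
     Y \<in> borel_measurable M \<and> integrable M (\<lambda>\<omega>. (norm (Y \<omega>))\<^sup>2)"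

text \<open>The sequence is indexed by the positive integers (the value at index 0 is irrelevant). The
  library's conditional expectation is real-valued, so the vector-valued one is taken
  coordinatewise.\<close>

definition L2_martingale_differences ::
    "'a measure \<Rightarrow> (nat \<Rightarrow> 'a measure) \<Rightarrow> (nat \<Rightarrow> 'a \<Rightarrow> 'b::euclidean_space) \<Rightarrow> bool" where
  "L2_martingale_differences M F N \<longleftrightarrow>
     (\<forall>n. N (Suc n) \<in> borel_measurable (F (Suc n)) \<and>
          square_integrable M (N (Suc n)) \<and>
          (\<forall>b\<in>Basis. AE \<omega> in M. real_cond_exp M (F n) (\<lambda>\<omega>. N (Suc n) \<omega> \<bullet> b) \<omega> = 0))"

text \<open>Momentum stochastic gradient descent for the gradient field \<open>G\<close>, with step sizes \<open>\<gamma>\<close>,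
  friction \<open>\<mu>\<close> and noise \<open>N\<close>; \<open>\<gamma>\<close> and \<open>N\<close> are used at positive indices only.\<close>

definition msgd ::
    "'a measure \<Rightarrow> ('b::euclidean_space \<Rightarrow> 'b) \<Rightarrow> real \<Rightarrow> (nat \<Rightarrow> real) \<Rightarrow>
     (nat \<Rightarrow> 'a \<Rightarrow> 'b) \<Rightarrow> (nat \<Rightarrow> 'a \<Rightarrow> 'b) \<Rightarrow> (nat \<Rightarrow> 'a \<Rightarrow> 'b) \<Rightarrow> bool" where
  "msgd M G \<mu> \<gamma> N X V \<longleftrightarrow>
     (\<forall>n. \<forall>\<omega>\<in>space M.
        X (Suc n) \<omega> = X n \<omega> + \<gamma> (Suc n) *\<^sub>R V (Suc n) \<omega> \<and>
        V (Suc n) \<omega> = V n \<omega> - (\<gamma> (Suc n) * \<mu>) *\<^sub>R V n \<omega> - \<gamma> (Suc n) *\<^sub>R G (X n \<omega>)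
                      + \<gamma> (Suc n) *\<^sub>R N (Suc n) \<omega>)"

definition stay_event :: "'a measure \<Rightarrow> (nat \<Rightarrow> 'a \<Rightarrow> 'b) \<Rightarrow> 'b set \<Rightarrow> nat \<Rightarrow> 'a set" where
  "stay_event M X \<D> n = {\<omega> \<in> space M. \<forall>i\<le>n. X i \<omega> \<in> \<D>}"

end

theory Submission
  imports Defs
begin

text \<open>
  The Lyapunov function is \<open>E(x,v) = a f(x) + b \<langle>\<nabla>f(x), v\<rangle> + |v|\<^sup>2/2\<close>. Along
  \<open>x' = v\<close>, \<open>v' = - \<mu> v - \<nabla>f(x)\<close> its derivative is at most
  \<open>(a - b \<mu> - 1) \<langle>\<nabla>f, v\<rangle> + (b C - \<mu>) |v|\<^sup>2 - b |\<nabla>f|\<^sup>2\<close>, and on \<open>\<D>\<close> this is at most \<open>- m E\<close> as soon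
  as \<open>a - b \<mu> - 1 = - m b\<close>, \<open>2 L b = m a\<close> and \<open>b C - \<mu> \<le> - m/2\<close>. As \<open>|\<nabla>f|\<^sup>2 \<le> 2 C f\<close>, the
  function \<open>E\<close> dominates a multiple of \<open>f + |v|\<^sup>2\<close> provided \<open>b\<^sup>2 C < a\<close>. One step of size \<open>h\<close>
  adds a centered noise term and an error \<open>O(h\<^sup>2) E\<close>, which the loss of \<open>\<epsilon>\<close> in the rate absorbs.

  At the extreme friction for \<open>\<kappa> = 1\<close> the strict inequality \<open>b\<^sup>2 C < a\<close> degenerates to an equality; it
  is restored by slightly lowering \<open>m\<close>. If \<open>\<kappa> < 1\<close> then \<open>f\<close> and \<open>\<nabla>f\<close> vanish on \<open>\<D>\<close>, and
  \<open>a = 1\<close>, \<open>b = 0\<close> gives the rate \<open>2 \<mu> \<ge> m\<close>.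
\<close>

section \<open>Nonnegative functions with Lipschitz gradient\<close>

locale smooth_nonneg =
  fixes f :: "'b::euclidean_space \<Rightarrow> real" and g :: "'b \<Rightarrow> 'b" and C :: real
  assumes gderiv: "GDERIV f x :> g x"
    and lip: "C-lipschitz_on UNIV g"
    and nonneg: "0 \<le> f x"
begin

lemma C_nonneg: "0 \<le> C"
  using lip lipschitz_on_nonneg by blast

lemma continuous_f: "continuous_on UNIV f"
  by (meson gderiv gderiv_def continuous_at_imp_continuous_on has_derivative_continuous)

lemma continuous_g: "continuous_on UNIV g"
  using lip lipschitz_on_continuous_on by blast

lemma norm_g_diff: "norm (g x - g y) \<le> C * norm (x - y)"
  using lipschitz_onD[OF lip, of x y] by (simp add: dist_norm)

text \<open>By the Lipschitz bound, the derivative of \<open>f (x + t *\<^sub>R d)\<close> in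
  \<open>t\<close> exceeds \<open>g x \<bullet> d\<close> by at most
  \<open>C * t * (norm d)\<^sup>2\<close>. The function \<open>?\<phi>\<close> subtracts the
  integral of this bound, so it is nonincreasing on [0,1], and its endpoint values give the
  claim.\<close>

lemma descent: "f (x + d) \<le> f x + g x \<bullet> d + C / 2 * (norm d)\<^sup>2"
proof -
  let ?\<phi> = "\<lambda>t. f (x + t *\<^sub>R d) - t * (g x \<bullet> d) - C * t\<^sup>2 * (norm d)\<^sup>2 / 2"
  have "?\<phi> 1 \<le> ?\<phi> 0"
  proof (rule DERIV_nonpos_imp_nonincreasing[of 0 1 ?\<phi>])
    fix t :: real assume t: "0 \<le> t" "t \<le> 1"
    have "(f has_derivative (\<lambda>h. h \<bullet> g (x + t *\<^sub>R d))) (at (x + t *\<^sub>R d))"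
      using gderiv[of "x + t *\<^sub>R d"] by (simp add: gderiv_def)
    then have "((\<lambda>t. f (x + t *\<^sub>R d)) has_derivative (\<lambda>h. (h *\<^sub>R d) \<bullet> g (x + t *\<^sub>R d))) (at t)"
      by (rule has_derivative_compose[rotated]) (auto intro!: derivative_eq_intros)
    then have "((\<lambda>t. f (x + t *\<^sub>R d)) has_real_derivative g (x + t *\<^sub>R d) \<bullet> d) (at t)"
      by (simp add: has_field_derivative_def inner_commute mult.commute[of _ "_ \<bullet> _"])
    then have "(?\<phi> has_real_derivative g (x + t *\<^sub>R d) \<bullet> d - g x \<bullet> d - C * t * (norm d)\<^sup>2) (at t)"
      by (auto intro!: derivative_eq_intros)
    moreover have "g (x + t *\<^sub>R d) \<bullet> d - g x \<bullet> d \<le> C * t * (norm d)\<^sup>2"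
    proof -
      have "(g (x + t *\<^sub>R d) - g x) \<bullet> d \<le> norm (g (x + t *\<^sub>R d) - g x) * norm d"
        by (rule norm_cauchy_schwarz)
      also have "\<dots> \<le> (C * norm (t *\<^sub>R d)) * norm d"
        using norm_g_diff[of "x + t *\<^sub>R d" x] by (intro mult_right_mono) auto
      finally show ?thesis using t by (simp add: inner_diff_left power2_eq_square algebra_simps)
    qed
    ultimately show "\<exists>y. (?\<phi> has_real_derivative y) (at t) \<and> y \<le> 0" by force
  qed simp
  then show ?thesis by simp
qed

text \<open>A gradient step of length \<open>t\<close> cannot push \<open>f\<close> below 0, while
  the descent inequality bounds the value reached. For \<open>C > 0\<close> the choice
  \<open>t = 1 / C\<close> is optimal; for \<open>C = 0\<close> nothing stops the descent, so a long
  enough step would make \<open>f\<close> negative unless the gradient vanishes.\<close>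

lemma norm_g_sq_le: "(norm (g x))\<^sup>2 \<le> 2 * C * f x"
proof -
  have *: "t * (norm (g x))\<^sup>2 \<le> f x + C / 2 * t\<^sup>2 * (norm (g x))\<^sup>2" for t
    using descent[of x "- t *\<^sub>R g x"] nonneg[of "x - t *\<^sub>R g x"]
    by (simp add: power_mult_distrib dot_square_norm algebra_simps)
  show ?thesis
  proof (cases "C = 0")
    case True
    have "norm (g x) = 0"
    proof (rule ccontr)
      assume "norm (g x) \<noteq> 0"
      then show False using *[of "(f x + 1) / (norm (g x))\<^sup>2"] True by simp
    qed
    then show ?thesis using True by simp
  next
    case False
    then show ?thesis using *[of "1 / C"] C_nonneg
      by (simp add: field_simps power2_eq_square)
  qed
qed

section \<open>The Lyapunov function: coercivity and one-step estimate\<close>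

definition energy :: "real \<Rightarrow> real \<Rightarrow> 'b \<Rightarrow> 'b \<Rightarrow> real" where
  "energy a b x v = a * f x + b * (g x \<bullet> v) + (norm v)\<^sup>2 / 2"

text \<open>Completing a square absorbs the cross term: it costs the fraction \<open>s\<close> of
  the kinetic energy and, since \<open>norm_g_sq_le\<close> converts the squared gradient into
  \<open>f\<close>, the amount \<open>b\<^sup>2 * C / s * f x\<close> of the potential part.\<close>

lemma energy_coercive:
  assumes "b\<^sup>2 * C < a"
  obtains c where "c > 0" "\<And>x v. c * (f x + (norm v)\<^sup>2) \<le> energy a b x v"
proof -
  have bC: "0 \<le> b\<^sup>2 * C" using C_nonneg by simp
  \<comment> \<open>The midpoint of \<open>b\<^sup>2 * C / a\<close> and 1, so that both remainders
    \<open>1 - s\<close> and \<open>a - b\<^sup>2 * C / s\<close> are positive.\<close>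
  define s where "s = (b\<^sup>2 * C + a) / (2 * a)"
  have s: "0 < s" "s < 1" using assms bC by (auto simp: s_def field_simps)
  have s2: "b\<^sup>2 * C / s < a" using assms bC by (auto simp: s_def field_simps power2_eq_square)
  define c where "c = min ((1 - s) / 2) (a - b\<^sup>2 * C / s)"
  show thesis
  proof
    show "c > 0" using s s2 by (simp add: c_def)
    fix x v
    have "0 \<le> (norm (s *\<^sub>R v + b *\<^sub>R g x))\<^sup>2 / (2 * s)" using s by simp
    also have "(norm (s *\<^sub>R v + b *\<^sub>R g x))\<^sup>2 =
        s\<^sup>2 * (norm v)\<^sup>2 + 2 * s * b * (g x \<bullet> v) + b\<^sup>2 * (norm (g x))\<^sup>2"
      unfolding power2_norm_eq_inner
      by (simp add: inner_commute[of v "g x"] power2_eq_square algebra_simps)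
    also have "(s\<^sup>2 * (norm v)\<^sup>2 + 2 * s * b * (g x \<bullet> v) + b\<^sup>2 * (norm (g x))\<^sup>2) / (2 * s) =
        s / 2 * (norm v)\<^sup>2 + b * (g x \<bullet> v) + b\<^sup>2 * (norm (g x))\<^sup>2 / (2 * s)"
      using s by (simp add: add_divide_distrib power2_eq_square)
    also have "b\<^sup>2 * (norm (g x))\<^sup>2 / (2 * s) \<le> b\<^sup>2 * (2 * C * f x) / (2 * s)"
      using norm_g_sq_le[of x] s by (intro divide_right_mono mult_left_mono) auto
    finally have "0 \<le> s / 2 * (norm v)\<^sup>2 + b * (g x \<bullet> v) + b\<^sup>2 * C / s * f x"
      by (simp add: mult_ac)
    moreover have "c * f x \<le> (a - b\<^sup>2 * C / s) * f x" "c * (norm v)\<^sup>2 \<le> (1 - s) / 2 * (norm v)\<^sup>2"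
      unfolding c_def by (intro mult_right_mono nonneg min.cobounded1 min.cobounded2 zero_le_power2)+
    ultimately have "c * f x + c * (norm v)\<^sup>2 \<le>
        a * f x + b * (g x \<bullet> v) + (norm v)\<^sup>2 / 2"
      by (simp add: left_diff_distrib diff_divide_distrib)
    then show "c * (f x + (norm v)\<^sup>2) \<le> energy a b x v"
      by (simp add: energy_def distrib_left)
  qed
qed

text \<open>The descent inequality handles \<open>a * f\<close> and the Lipschitz bound handles the
  cross term; \<open>q\<close> gathers the resulting coefficients of
  \<open>(norm v')\<^sup>2\<close>. Expanding \<open>v' = w + h *\<^sub>R d\<close> leaves a
  noise-free part, a part linear in \<open>d\<close> that will have mean zero, and a quadratic part.
  Adding and subtracting \<open>\<sigma> * f x\<close> gives the quadratic part a nonpositive mean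
  under the variance assumption.\<close>

lemma energy_upper:
  assumes "b \<ge> 0" "a \<ge> 0" "w = v - (h * \<mu>) *\<^sub>R v - h *\<^sub>R g x" "v' = w + h *\<^sub>R d" "h > 0"
    and q: "q = a * C * h\<^sup>2 / 2 + b * C * h + 1 / 2"
  shows "energy a b (x + h *\<^sub>R v') v' \<le>
    a * f x + (a * h + b) * (g x \<bullet> w) + q * ((norm w)\<^sup>2 + h\<^sup>2 * \<sigma> * f x)
    + (((a * h + b) * h) *\<^sub>R g x + (2 * q * h) *\<^sub>R w) \<bullet> d
    + q * h\<^sup>2 * ((norm d)\<^sup>2 - \<sigma> * f x)"
proof -
  have "a * f (x + h *\<^sub>R v') \<le> a * (f x + h * (g x \<bullet> v') + C / 2 * h\<^sup>2 * (norm v')\<^sup>2)"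
    using descent[of x "h *\<^sub>R v'"] \<open>a \<ge> 0\<close>
    by (intro mult_left_mono) (auto simp: power_mult_distrib)
  moreover have "b * (g (x + h *\<^sub>R v') \<bullet> v') \<le> b * (g x \<bullet> v' + C * h * (norm v')\<^sup>2)"
  proof (rule mult_left_mono)
    have "(g (x + h *\<^sub>R v') - g x) \<bullet> v' \<le> norm (g (x + h *\<^sub>R v') - g x) * norm v'"
      by (rule norm_cauchy_schwarz)
    also have "\<dots> \<le> (C * norm (h *\<^sub>R v')) * norm v'"
      using norm_g_diff[of "x + h *\<^sub>R v'" x] by (intro mult_right_mono) auto
    finally show "g (x + h *\<^sub>R v') \<bullet> v' \<le> g x \<bullet> v' + C * h * (norm v')\<^sup>2"
      using \<open>h > 0\<close> by (simp add: inner_diff_left power2_eq_square mult_ac)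
  qed fact
  ultimately have "energy a b (x + h *\<^sub>R v') v' \<le> a * f x + (a * h + b) * (g x \<bullet> v') + q * (norm v')\<^sup>2"
    by (simp add: energy_def q algebra_simps)
  also have "(norm v')\<^sup>2 = (norm w)\<^sup>2 + 2 * h * (w \<bullet> d) + h\<^sup>2 * (norm d)\<^sup>2"
    unfolding assms(4) power2_norm_eq_inner
    by (simp add: inner_commute[of d w] power2_eq_square algebra_simps)
  also have "g x \<bullet> v' = g x \<bullet> w + h * (g x \<bullet> d)"
    by (simp add: assms(4) algebra_simps)
  finally show ?thesis by (simp add: algebra_simps)
qed

text \<open>Sorts the noise-free part by order in \<open>h\<close>. The factor of \<open>h\<close>
  is the bound for the derivative of the energy along the continuous flow; the factor of
  \<open>h\<^sup>2\<close> still contains \<open>h\<close> and \<open>q\<close> and is bounded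
  uniformly below.\<close>

lemma drift_expansion:
  assumes w: "w = v - (h * \<mu>) *\<^sub>R v - h *\<^sub>R g x"
    and q: "q = a * C * h\<^sup>2 / 2 + b * C * h + 1 / 2"
  shows "a * f x + (a * h + b) * (g x \<bullet> w) + q * ((norm w)\<^sup>2 + h\<^sup>2 * \<sigma> * f x) =
    energy a b x v
    + h * ((a - b * \<mu> - 1) * (g x \<bullet> v) + (b * C - \<mu>) * (norm v)\<^sup>2 - b * (norm (g x))\<^sup>2)
    + h\<^sup>2 * ((q - a) * (norm (g x))\<^sup>2
      + (2 * q * \<mu> - a * \<mu> - a * C * h - 2 * b * C) * (g x \<bullet> v)
      + (a * C / 2 + q * \<mu>\<^sup>2 - a * C * h * \<mu> - 2 * b * C * \<mu>) * (norm v)\<^sup>2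
      + q * \<sigma> * f x)"
proof -
  have 1: "g x \<bullet> w = (1 - h * \<mu>) * (g x \<bullet> v) - h * (norm (g x))\<^sup>2"
    by (simp add: w power2_norm_eq_inner algebra_simps)
  have 2: "(norm w)\<^sup>2 = (1 - h * \<mu>)\<^sup>2 * (norm v)\<^sup>2 - 2 * h * (1 - h * \<mu>) * (g x \<bullet> v) + h\<^sup>2 * (norm (g x))\<^sup>2"
    unfolding w power2_norm_eq_inner
    by (simp add: inner_commute[of v "g x"] power2_eq_square algebra_simps)
  show ?thesis unfolding 1 2 energy_def q
    by (simp add: power2_eq_square field_simps)
qed

text \<open>The coefficients are continuous in \<open>h\<close>, hence bounded on [0,1]. The terms
  they multiply are dominated by multiples of \<open>f x + (norm v)\<^sup>2\<close>, and coercivity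
  bounds this by the energy.\<close>

lemma remainder_bound:
  assumes "b\<^sup>2 * C < a"
  obtains K where "K \<ge> 0" "\<And>h x v q. \<lbrakk>0 < h; h \<le> 1; q = a * C * h\<^sup>2 / 2 + b * C * h + 1 / 2\<rbrakk> \<Longrightarrow>
     (q - a) * (norm (g x))\<^sup>2
      + (2 * q * \<mu> - a * \<mu> - a * C * h - 2 * b * C) * (g x \<bullet> v)
      + (a * C / 2 + q * \<mu>\<^sup>2 - a * C * h * \<mu> - 2 * b * C * \<mu>) * (norm v)\<^sup>2
      + q * \<sigma> * f x \<le> K * energy a b x v"
proof -
  obtain c where c: "c > 0" "\<And>x v. c * (f x + (norm v)\<^sup>2) \<le> energy a b x v"
    using energy_coercive[OF assms] by blast
  define q where "q h = a * C * h\<^sup>2 / 2 + b * C * h + 1 / 2" for h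
  have bdd: "\<exists>B. \<forall>h\<in>{0..1}. \<bar>r h\<bar> \<le> B" if "continuous_on {0..1} r" for r :: "real \<Rightarrow> real"
    using compact_imp_bounded[OF compact_continuous_image[OF that compact_Icc]]
    by (auto simp: bounded_iff)
  have "\<exists>B. \<forall>h\<in>{0..1}. \<bar>q h - a\<bar> \<le> B"
    by (rule bdd) (auto simp: q_def intro!: continuous_intros)
  then obtain B1 where B1: "\<And>h. 0 < h \<Longrightarrow> h \<le> 1 \<Longrightarrow> \<bar>q h - a\<bar> \<le> B1" by force
  have "\<exists>B. \<forall>h\<in>{0..1}. \<bar>2 * q h * \<mu> - a * \<mu> - a * C * h - 2 * b * C\<bar> \<le> B"
    by (rule bdd) (auto simp: q_def intro!: continuous_intros)
  then obtain B2 where B2: "\<And>h. 0 < h \<Longrightarrow> h \<le> 1 \<Longrightarrow>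
      \<bar>2 * q h * \<mu> - a * \<mu> - a * C * h - 2 * b * C\<bar> \<le> B2" by force
  have "\<exists>B. \<forall>h\<in>{0..1}. \<bar>a * C / 2 + q h * \<mu>\<^sup>2 - a * C * h * \<mu> - 2 * b * C * \<mu>\<bar> \<le> B"
    by (rule bdd) (auto simp: q_def intro!: continuous_intros)
  then obtain B3 where B3: "\<And>h. 0 < h \<Longrightarrow> h \<le> 1 \<Longrightarrow>
      \<bar>a * C / 2 + q h * \<mu>\<^sup>2 - a * C * h * \<mu> - 2 * b * C * \<mu>\<bar> \<le> B3" by force
  have "\<exists>B. \<forall>h\<in>{0..1}. \<bar>q h * \<sigma>\<bar> \<le> B"
    by (rule bdd) (auto simp: q_def intro!: continuous_intros)
  then obtain B4 where B4: "\<And>h. 0 < h \<Longrightarrow> h \<le> 1 \<Longrightarrow> \<bar>q h * \<sigma>\<bar> \<le> B4" by force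
  define B where "B = max (max B1 B2) (max B3 B4)"
  have "\<bar>q 1 - a\<bar> \<le> B1" by (rule B1) auto
  then have B: "B \<ge> 0" by (simp add: B_def)
  \<comment> \<open>The part \<open>3 * C\<close> comes from \<open>norm_g_sq_le\<close> applied to
    3/2 of the squared gradient, the remaining 3 generously covers \<open>f x\<close> and 3/2 of
    \<open>(norm v)\<^sup>2\<close>, and dividing by \<open>c\<close> passes to the energy.\<close>
  define K where "K = B * (1 + 3 * C + 2) / c"
  have "B * (1 + 3 * C + 2) \<ge> 0" using B C_nonneg by simp
  then have K: "K \<ge> 0" using c by (simp add: K_def)
  show thesis
  proof (rule that[OF K])
    fix h x v q' assume h: "0 < h" "h \<le> 1" and q': "q' = a * C * h\<^sup>2 / 2 + b * C * h + 1 / 2"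
    have qq: "q' = q h" by (simp add: q' q_def)
    have P: "\<bar>g x \<bullet> v\<bar> \<le> ((norm (g x))\<^sup>2 + (norm v)\<^sup>2) / 2"
      using Cauchy_Schwarz_ineq2[of "g x" v] sum_squares_bound[of "norm (g x)" "norm v"] by simp
    have prod: "r * y \<le> B * z" if "\<bar>r\<bar> \<le> B" "\<bar>y\<bar> \<le> z" for r y z
      using mult_mono[OF that B] abs_le_D1[of "r * y"] by (simp add: abs_mult)
    have "(q h - a) * (norm (g x))\<^sup>2
      + (2 * q h * \<mu> - a * \<mu> - a * C * h - 2 * b * C) * (g x \<bullet> v)
      + (a * C / 2 + q h * \<mu>\<^sup>2 - a * C * h * \<mu> - 2 * b * C * \<mu>) * (norm v)\<^sup>2
      + (q h * \<sigma>) * f x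
      \<le> B * (norm (g x))\<^sup>2 + B * (((norm (g x))\<^sup>2 + (norm v)\<^sup>2) / 2) + B * (norm v)\<^sup>2 + B * f x"
      using B1[OF h] B2[OF h] B3[OF h] B4[OF h] P nonneg[of x]
      by (intro add_mono prod) (auto simp: B_def)
    also have "\<dots> = B * (3 / 2 * (norm (g x))\<^sup>2 + 3 / 2 * (norm v)\<^sup>2 + f x)"
      by (simp add: field_simps)
    also have "\<dots> \<le> B * ((1 + 3 * C + 2) * (f x + (norm v)\<^sup>2))"
    proof (rule mult_left_mono[OF _ B])
      have "(1 + 3 * C + 2) * (f x + (norm v)\<^sup>2)
          = 3 * f x + 3 * (norm v)\<^sup>2 + 3 * (C * f x) + 3 * (C * (norm v)\<^sup>2)"
        by (simp add: algebra_simps)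
      moreover have "0 \<le> C * (norm v)\<^sup>2" using C_nonneg by simp
      ultimately show "3 / 2 * (norm (g x))\<^sup>2 + 3 / 2 * (norm v)\<^sup>2 + f x
          \<le> (1 + 3 * C + 2) * (f x + (norm v)\<^sup>2)"
        using norm_g_sq_le[of x] nonneg[of x] zero_le_power2[of "norm v"] by linarith
    qed
    also have "\<dots> = K * (c * (f x + (norm v)\<^sup>2))" using c by (simp add: K_def)
    also have "\<dots> \<le> K * energy a b x v" by (intro mult_left_mono c K)
    finally show "(q' - a) * (norm (g x))\<^sup>2
      + (2 * q' * \<mu> - a * \<mu> - a * C * h - 2 * b * C) * (g x \<bullet> v)
      + (a * C / 2 + q' * \<mu>\<^sup>2 - a * C * h * \<mu> - 2 * b * C * \<mu>) * (norm v)\<^sup>2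
      + q' * \<sigma> * f x \<le> K * energy a b x v" by (simp add: qq)
  qed
qed

text \<open>The drift inequality is demanded only at the current point, so it can later be supplied
  on \<D> alone. The constant \<open>K\<close> is fixed before the step size, the state and the
  noise.\<close>

lemma energy_step:
  assumes "b\<^sup>2 * C < a" "b \<ge> 0"
  obtains K where "K \<ge> 0" "\<And>h x v d w v' q.
    \<lbrakk>0 < h; h \<le> 1; w = v - (h * \<mu>) *\<^sub>R v - h *\<^sub>R g x; v' = w + h *\<^sub>R d;
     q = a * C * h\<^sup>2 / 2 + b * C * h + 1 / 2;
     (a - b * \<mu> - 1) * (g x \<bullet> v) + (b * C - \<mu>) * (norm v)\<^sup>2 - b * (norm (g x))\<^sup>2
       \<le> - m * energy a b x v\<rbrakk> \<Longrightarrow>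
    energy a b (x + h *\<^sub>R v') v' \<le> (1 - m * h + K * h\<^sup>2) * energy a b x v
      + (((a * h + b) * h) *\<^sub>R g x + (2 * q * h) *\<^sub>R w) \<bullet> d
      + q * h\<^sup>2 * ((norm d)\<^sup>2 - \<sigma> * f x)"
proof -
  have "0 \<le> b\<^sup>2 * C" using C_nonneg by simp
  then have a: "a \<ge> 0" using assms(1) by linarith
  obtain K where K: "K \<ge> 0" "\<And>h x v q. \<lbrakk>0 < h; h \<le> 1; q = a * C * h\<^sup>2 / 2 + b * C * h + 1 / 2\<rbrakk> \<Longrightarrow>
     (q - a) * (norm (g x))\<^sup>2
      + (2 * q * \<mu> - a * \<mu> - a * C * h - 2 * b * C) * (g x \<bullet> v)
      + (a * C / 2 + q * \<mu>\<^sup>2 - a * C * h * \<mu> - 2 * b * C * \<mu>) * (norm v)\<^sup>2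
      + q * \<sigma> * f x \<le> K * energy a b x v"
    using remainder_bound[OF assms(1), of \<mu> \<sigma>] by blast
  show thesis
  proof (rule that[OF K(1)])
    fix h x v d w v' q
    assume h: "0 < h" "h \<le> 1" and w: "w = v - (h * \<mu>) *\<^sub>R v - h *\<^sub>R g x" and v': "v' = w + h *\<^sub>R d"
      and q: "q = a * C * h\<^sup>2 / 2 + b * C * h + 1 / 2"
      and drift: "(a - b * \<mu> - 1) * (g x \<bullet> v) + (b * C - \<mu>) * (norm v)\<^sup>2 - b * (norm (g x))\<^sup>2
       \<le> - m * energy a b x v"
    have "a * f x + (a * h + b) * (g x \<bullet> w) + q * ((norm w)\<^sup>2 + h\<^sup>2 * \<sigma> * f x)
        \<le> energy a b x v + h * (- m * energy a b x v) + h\<^sup>2 * (K * energy a b x v)"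
      unfolding drift_expansion[OF w q]
      using h by (intro add_mono mult_left_mono drift K(2)[OF h q]) auto
    also have "\<dots> = (1 - m * h + K * h\<^sup>2) * energy a b x v"
      by (simp add: algebra_simps)
    finally show "energy a b (x + h *\<^sub>R v') v' \<le> (1 - m * h + K * h\<^sup>2) * energy a b x v
      + (((a * h + b) * h) *\<^sub>R g x + (2 * q * h) *\<^sub>R w) \<bullet> d
      + q * h\<^sup>2 * ((norm d)\<^sup>2 - \<sigma> * f x)"
      using energy_upper[OF \<open>b \<ge> 0\<close> a w v' \<open>0 < h\<close> q, of \<sigma>] by linarith
  qed
qed

end

section \<open>Square-integrable vectors and conditional expectation\<close>

lemma square_integrable_cong:
  assumes "square_integrable M Z" "\<And>\<omega>. \<omega> \<in> space M \<Longrightarrow> Y \<omega> = Z \<omega>"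
  shows "square_integrable M Y"
  using assms measurable_cong[of M Y Z borel]
    Bochner_Integration.integrable_cong[of M M "\<lambda>\<omega>. (norm (Y \<omega>))\<^sup>2" "\<lambda>\<omega>. (norm (Z \<omega>))\<^sup>2"]
  by (simp add: square_integrable_def)

context prob_space
begin

text \<open>The square of \<open>A + B * norm y\<close> is at most
  \<open>2 * A\<^sup>2 + 2 * B\<^sup>2 * (norm y)\<^sup>2\<close>, and constants are integrable on a
  probability space. Serves both the Lipschitz gradient and coordinate projections.\<close>

lemma square_integrable_affine_bound:
  fixes Y :: "'a \<Rightarrow> 'b::euclidean_space" and h :: "'b \<Rightarrow> 'c::euclidean_space"
  assumes "square_integrable M Y" and [measurable]: "h \<in> borel_measurable borel"
    and bound: "\<And>y. norm (h y) \<le> A + B * norm y"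
  shows "square_integrable M (\<lambda>\<omega>. h (Y \<omega>))"
proof -
  have [measurable]: "Y \<in> borel_measurable M" and int: "integrable M (\<lambda>\<omega>. (norm (Y \<omega>))\<^sup>2)"
    using assms(1) by (auto simp: square_integrable_def)
  have "integrable M (\<lambda>\<omega>. (norm (h (Y \<omega>)))\<^sup>2)"
  proof (rule Bochner_Integration.integrable_bound)
    show "integrable M (\<lambda>\<omega>. 2 * A\<^sup>2 + 2 * B\<^sup>2 * (norm (Y \<omega>))\<^sup>2)"
      using int by simp
    show "AE \<omega> in M. norm ((norm (h (Y \<omega>)))\<^sup>2) \<le> norm (2 * A\<^sup>2 + 2 * B\<^sup>2 * (norm (Y \<omega>))\<^sup>2)"
    proof (rule AE_I2)
      fix \<omega>
      have "(norm (h (Y \<omega>)))\<^sup>2 \<le> (A + B * norm (Y \<omega>))\<^sup>2"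
        by (intro power_mono bound) simp
      also have "\<dots> \<le> 2 * A\<^sup>2 + 2 * B\<^sup>2 * (norm (Y \<omega>))\<^sup>2"
        using sum_squares_bound[of A "B * norm (Y \<omega>)"]
        by (simp add: power2_sum power_mult_distrib)
      finally show "norm ((norm (h (Y \<omega>)))\<^sup>2) \<le> norm (2 * A\<^sup>2 + 2 * B\<^sup>2 * (norm (Y \<omega>))\<^sup>2)"
        by simp
    qed
  qed measurable
  then show ?thesis by (simp add: square_integrable_def)
qed

lemma integrable_inner_square_integrable:
  fixes Y Z :: "'a \<Rightarrow> 'b::euclidean_space"
  assumes "square_integrable M Y" "square_integrable M Z"
  shows "integrable M (\<lambda>\<omega>. Y \<omega> \<bullet> Z \<omega>)"
proof -
  have [measurable]: "Y \<in> borel_measurable M" "Z \<in> borel_measurable M"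
    and int: "integrable M (\<lambda>\<omega>. (norm (Y \<omega>))\<^sup>2)" "integrable M (\<lambda>\<omega>. (norm (Z \<omega>))\<^sup>2)"
    using assms by (auto simp: square_integrable_def)
  show ?thesis
  proof (rule Bochner_Integration.integrable_bound)
    show "integrable M (\<lambda>\<omega>. (norm (Y \<omega>))\<^sup>2 + (norm (Z \<omega>))\<^sup>2)" using int by simp
    show "AE \<omega> in M. norm (Y \<omega> \<bullet> Z \<omega>) \<le> norm ((norm (Y \<omega>))\<^sup>2 + (norm (Z \<omega>))\<^sup>2)"
    proof (rule AE_I2)
      fix \<omega>
      show "norm (Y \<omega> \<bullet> Z \<omega>) \<le> norm ((norm (Y \<omega>))\<^sup>2 + (norm (Z \<omega>))\<^sup>2)"
        using Cauchy_Schwarz_ineq2[of "Y \<omega>" "Z \<omega>"] sum_squares_bound[of "norm (Y \<omega>)" "norm (Z \<omega>)"]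
          mult_nonneg_nonneg[of "norm (Y \<omega>)" "norm (Z \<omega>)"]
        by simp
    qed
  qed measurable
qed

lemma square_integrable_add:
  fixes Y Z :: "'a \<Rightarrow> 'b::euclidean_space"
  assumes "square_integrable M Y" "square_integrable M Z"
  shows "square_integrable M (\<lambda>\<omega>. Y \<omega> + Z \<omega>)"
proof -
  have "integrable M (\<lambda>\<omega>. (norm (Y \<omega>))\<^sup>2 + 2 * (Y \<omega> \<bullet> Z \<omega>) + (norm (Z \<omega>))\<^sup>2)"
    using assms integrable_inner_square_integrable[OF assms] by (auto simp: square_integrable_def)
  moreover have "(norm (Y \<omega> + Z \<omega>))\<^sup>2 = (norm (Y \<omega>))\<^sup>2 + 2 * (Y \<omega> \<bullet> Z \<omega>) + (norm (Z \<omega>))\<^sup>2" for \<omega>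
    unfolding power2_norm_eq_inner by (simp add: inner_commute[of "Z \<omega>" "Y \<omega>"] algebra_simps)
  ultimately show ?thesis using assms by (auto simp: square_integrable_def)
qed

lemma square_integrable_scaleR:
  fixes Y :: "'a \<Rightarrow> 'b::euclidean_space"
  assumes "square_integrable M Y"
  shows "square_integrable M (\<lambda>\<omega>. c *\<^sub>R Y \<omega>)"
  using assms by (auto simp: square_integrable_def power_mult_distrib)

lemma square_integrable_diff:
  fixes Y Z :: "'a \<Rightarrow> 'b::euclidean_space"
  assumes "square_integrable M Y" "square_integrable M Z"
  shows "square_integrable M (\<lambda>\<omega>. Y \<omega> - Z \<omega>)"
  using square_integrable_add[OF assms(1) square_integrable_scaleR[OF assms(2), of "-1"]] by simp

lemma square_integrable_indicator:
  fixes Y :: "'a \<Rightarrow> 'b::euclidean_space"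
  assumes "square_integrable M Y" and A: "A \<in> sets M"
  shows "square_integrable M (\<lambda>\<omega>. indicat_real A \<omega> *\<^sub>R Y \<omega>)"
proof -
  have "(norm (indicat_real A \<omega> *\<^sub>R Y \<omega>))\<^sup>2 = indicat_real A \<omega> *\<^sub>R (norm (Y \<omega>))\<^sup>2" for \<omega>
    by (auto simp: indicator_def)
  then show ?thesis
    using assms integrable_mult_indicator[OF A, of "\<lambda>\<omega>. (norm (Y \<omega>))\<^sup>2"]
    by (auto simp: square_integrable_def)
qed

text \<open>Centering is given coordinatewise, so the inner product is split over
  \<open>Basis\<close>; each coordinate of \<open>U\<close> is \<open>G\<close>-measurable and
  passes through the conditional expectation.\<close>

lemma integral_inner_centered:
  fixes U D :: "'a \<Rightarrow> 'b::euclidean_space"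
  assumes "subalgebra M G" and U[measurable]: "U \<in> borel_measurable G"
    and sq: "square_integrable M U" "square_integrable M D"
    and centered: "\<And>b. b \<in> Basis \<Longrightarrow> AE \<omega> in M. real_cond_exp M G (\<lambda>\<omega>. D \<omega> \<bullet> b) \<omega> = 0"
  shows "(\<integral>\<omega>. U \<omega> \<bullet> D \<omega> \<partial>M) = 0"
proof -
  interpret finite_measure_subalgebra M G
    using assms(1) by unfold_locales
  have [measurable]: "D \<in> borel_measurable M" using sq(2) by (simp add: square_integrable_def)
  \<comment> \<open>The coordinate product is the inner product of \<open>D\<close> with the
    projection of \<open>U\<close> onto the line through \<open>b\<close>.\<close>
  have comp: "integrable M (\<lambda>\<omega>. (U \<omega> \<bullet> b) * (D \<omega> \<bullet> b))" if "b \<in> Basis" for b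
  proof -
    have "square_integrable M (\<lambda>\<omega>. (U \<omega> \<bullet> b) *\<^sub>R b)"
      by (rule square_integrable_affine_bound[OF sq(1), where A = 0 and B = 1])
        (use that in \<open>auto simp: Basis_le_norm\<close>)
    from integrable_inner_square_integrable[OF this sq(2)]
    show ?thesis by (simp add: inner_commute)
  qed
  have "(\<integral>\<omega>. U \<omega> \<bullet> D \<omega> \<partial>M) = (\<integral>\<omega>. (\<Sum>b\<in>Basis. (U \<omega> \<bullet> b) * (D \<omega> \<bullet> b)) \<partial>M)"
    by (intro Bochner_Integration.integral_cong refl euclidean_inner)
  also have "\<dots> = (\<Sum>b\<in>Basis. \<integral>\<omega>. (U \<omega> \<bullet> b) * (D \<omega> \<bullet> b) \<partial>M)"
    by (rule Bochner_Integration.integral_sum) (rule comp)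
  also have "\<dots> = 0"
  proof (rule sum.neutral, rule ballI)
    fix b :: 'b assume b: "b \<in> Basis"
    have "(\<integral>\<omega>. (U \<omega> \<bullet> b) * (D \<omega> \<bullet> b) \<partial>M) =
        (\<integral>\<omega>. (U \<omega> \<bullet> b) * real_cond_exp M G (\<lambda>\<omega>. D \<omega> \<bullet> b) \<omega> \<partial>M)"
      by (rule real_cond_exp_intg(2)[symmetric]) (use comp[OF b] in auto)
    also have "\<dots> = (\<integral>\<omega>. 0 \<partial>M)"
      by (rule Bochner_Integration.integral_cong_AE) (use centered[OF b] in \<open>auto intro: borel_measurable_times measurable_from_subalg[OF assms(1)]\<close>)
    finally show "(\<integral>\<omega>. (U \<omega> \<bullet> b) * (D \<omega> \<bullet> b) \<partial>M) = 0" by simp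
  qed
  finally show ?thesis .
qed

text \<open>As \<open>A\<close> belongs to \<open>G\<close>, its indicator passes through the
  conditional expectation, so a bound known only on \<open>A\<close> still compares means.\<close>

lemma integral_indicator_le_cond_exp:
  assumes "subalgebra M G" "A \<in> sets G" "integrable M Y" "integrable M Z"
    and le: "AE \<omega> in M. \<omega> \<in> A \<longrightarrow> real_cond_exp M G Y \<omega> \<le> Z \<omega>"
  shows "(\<integral>\<omega>. indicat_real A \<omega> * Y \<omega> \<partial>M) \<le> (\<integral>\<omega>. indicat_real A \<omega> * Z \<omega> \<partial>M)"
proof -
  interpret finite_measure_subalgebra M G
    using assms(1) by unfold_locales
  have A: "A \<in> sets M" using assms(1,2) by (auto simp: subalgebra_def)
  have intY: "integrable M (\<lambda>\<omega>. indicat_real A \<omega> * Y \<omega>)"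
    and intZ: "integrable M (\<lambda>\<omega>. indicat_real A \<omega> * Z \<omega>)"
    using integrable_mult_indicator[OF A assms(3)] integrable_mult_indicator[OF A assms(4)]
    by simp_all
  note [measurable] = assms(2)
  have "(\<integral>\<omega>. indicat_real A \<omega> * Y \<omega> \<partial>M) = (\<integral>\<omega>. indicat_real A \<omega> * real_cond_exp M G Y \<omega> \<partial>M)"
    by (rule real_cond_exp_intg(2)[symmetric]) (use intY assms(3) in auto)
  also have "\<dots> \<le> (\<integral>\<omega>. indicat_real A \<omega> * Z \<omega> \<partial>M)"
    by (rule integral_mono_AE[OF real_cond_exp_intg(1) intZ])
      (use intY assms(3) le in \<open>auto elim!: eventually_mono simp: indicator_def\<close>)
  finally show ?thesis .
qed

end

section \<open>Coefficients of the Lyapunov function\<close>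

text \<open>
  Solving the two equations gives \<open>b = m / (2 L + m\<^sup>2 - m \<mu>)\<close> and \<open>a = 2 L b / m\<close>; the hypotheses say
  that this \<open>b\<close> is positive, \<open>b C \<le> \<mu> - m/2\<close> and \<open>b\<^sup>2 C \<le> a\<close>. Below \<open>sqrt (2 L)\<close> the value of
  \<open>b\<close> increases with \<open>m\<close>, so a smaller rate makes the last inequality strict.
\<close>

lemma friction_parameters:
  fixes C L \<mu> m \<epsilon> :: real
  assumes "L > 0" "C \<ge> L" "\<mu> > 0" "m > 0" "\<epsilon> > 0" "m\<^sup>2 \<le> 2 * L"
    and Q: "m * \<mu> < 2 * L + m\<^sup>2"
    and kin: "C * m \<le> (\<mu> - m / 2) * (2 * L + m\<^sup>2 - m * \<mu>)"
    and pot: "m\<^sup>2 * C \<le> 2 * L * (2 * L + m\<^sup>2 - m * \<mu>)"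
  obtains m' a b where "m - \<epsilon> \<le> m'" "b\<^sup>2 * C < a" "b \<ge> 0"
    "a - b * \<mu> - 1 = - m' * b" "b * C - \<mu> \<le> - m' / 2" "2 * L * b = m' * a"
proof -
  \<comment> \<open>The term \<open>m / 2\<close> keeps \<open>m'\<close> positive when \<epsilon>
    is large.\<close>
  define m' where "m' = max (m / 2) (m - \<epsilon>)"
  have m': "0 < m'" "m' < m" "m - \<epsilon> \<le> m'" using assms by (auto simp: m'_def)
  define Q0 where "Q0 = 2 * L + m\<^sup>2 - m * \<mu>"
  define Q' where "Q' = 2 * L + m'\<^sup>2 - m' * \<mu>"
  have Q0: "Q0 > 0" using Q by (simp add: Q0_def)
  \<comment> \<open>This is the monotonicity of \<open>b\<close> in the rate, cross-multiplied: the
    two sides differ by \<open>(m - m') * (2 * L - m * m')\<close>. It also yields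
    \<open>Q' > 0\<close>.\<close>
  have less: "m' * Q0 \<le> m * Q'"
  proof -
    have "m' * m \<le> m * m" using m' by simp
    then have "m * m' \<le> 2 * L" using assms(6) by (simp add: power2_eq_square mult.commute)
    then have "0 \<le> (m - m') * (2 * L - m * m')"
      using m' by (intro mult_nonneg_nonneg) auto
    then show ?thesis by (simp add: Q0_def Q'_def power2_eq_square algebra_simps)
  qed
  have "0 < m' * Q0" using m' Q0 by simp
  then have Q': "Q' > 0" using less zero_less_mult_pos[of m Q'] \<open>m > 0\<close> by linarith
  define b where "b = m' / Q'"
  define a where "a = 2 * L * b / m'"
  have b: "b > 0" using m' Q' by (simp add: b_def)
  have bm: "b \<le> m / Q0" using less Q0 Q' by (simp add: b_def field_simps)
  have C: "C > 0" using assms by simp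
  have bC: "b * C \<le> m / Q0 * C" using bm C by (intro mult_right_mono) auto
  have kin': "m / Q0 * C \<le> \<mu> - m / 2" using kin Q0 unfolding Q0_def[symmetric]
    by (simp add: pos_divide_le_eq mult.commute)
  have pot': "m / Q0 * C \<le> 2 * L / m" using pot Q0 \<open>m > 0\<close>
    unfolding Q0_def[symmetric] by (simp add: field_simps power2_eq_square)
  \<comment> \<open>Here \<open>m' < m\<close> turns the weak potential condition into a strict
    one.\<close>
  have "2 * L / m < 2 * L / m'" using m' \<open>L > 0\<close> by (intro divide_strict_left_mono) auto
  then have "b * C < 2 * L / m'" using bC pot' by linarith
  then have "b * (b * C) < b * (2 * L / m')" using b by (rule mult_strict_left_mono)
  then have 1: "b\<^sup>2 * C < a" by (simp add: a_def power2_eq_square mult_ac)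
  have bQ: "b * Q' = m'" using Q' by (simp add: b_def)
  \<comment> \<open>Multiplying by \<open>m'\<close> clears the denominator of \<open>a\<close> and
    reduces the equation to \<open>b * Q' = m'\<close>.\<close>
  have "m' * (a - b * \<mu> - 1) = m' * (- m' * b)"
    using bQ m' by (simp add: a_def Q'_def power2_eq_square algebra_simps)
  then have 2: "a - b * \<mu> - 1 = - m' * b" using m' by (simp only: mult_cancel_left) simp
  show thesis
    by (rule that[OF m'(3) 1 _ 2]) (use b bC kin' m' in \<open>auto simp: a_def\<close>)
qed

section \<open>The process: measurability, integrability and decay of the mean energy\<close>

lemma stay_event_measurable:
  assumes "filtration (space M) F" "adapted F X" and D: "\<D> \<in> sets borel"
  shows "stay_event M X \<D> n \<in> sets (F n)"
proof -
  have "X i -` \<D> \<inter> space (F n) \<in> sets (F n)" if "i \<le> n" for i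
  proof -
    have "X i -` \<D> \<inter> space (F i) \<in> sets (F i)"
      using assms(2) D by (auto simp: adapted_def intro: measurable_sets)
    then show ?thesis
      using filtration.sets_F_mono[OF assms(1) that] filtration.space_F[OF assms(1)] by auto
  qed
  then have "(\<Inter>i\<in>{..n}. X i -` \<D> \<inter> space (F n)) \<in> sets (F n)"
    by (intro sets.finite_INT) auto
  also have "(\<Inter>i\<in>{..n}. X i -` \<D> \<inter> space (F n)) = stay_event M X \<D> n"
    using filtration.space_F[OF assms(1)] by (auto simp: stay_event_def)
  finally show ?thesis .
qed

context smooth_nonneg
begin

lemma square_integrable_g:
  assumes "prob_space M" "square_integrable M Y"
  shows "square_integrable M (\<lambda>\<omega>. g (Y \<omega>))"
proof (rule prob_space.square_integrable_affine_bound[OF assms])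
  show "g \<in> borel_measurable borel"
    using continuous_g by (rule borel_measurable_continuous_onI)
  show "norm (g y) \<le> norm (g 0) + C * norm y" for y
    using norm_g_diff[of y 0] norm_triangle_ineq2[of "g y" "g 0"] by simp
qed

text \<open>The descent inequality at base point 0 gives \<open>f\<close> at most quadratic growth,
  so second moments suffice.\<close>

lemma integrable_f:
  assumes "prob_space M" and Y: "square_integrable M Y"
  shows "integrable M (\<lambda>\<omega>. f (Y \<omega>))"
proof -
  interpret prob_space M by fact
  have Ym[measurable]: "Y \<in> borel_measurable M" and int: "integrable M (\<lambda>\<omega>. (norm (Y \<omega>))\<^sup>2)"
    using Y by (auto simp: square_integrable_def)
  have [measurable]: "f \<in> borel_measurable borel"
    using continuous_f by (rule borel_measurable_continuous_onI)
  have c: "square_integrable M (\<lambda>\<omega>. g 0)" by (simp add: square_integrable_def)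
  show ?thesis
  proof (rule Bochner_Integration.integrable_bound)
    show "integrable M (\<lambda>\<omega>. f 0 + g 0 \<bullet> Y \<omega> + C / 2 * (norm (Y \<omega>))\<^sup>2)"
      using int integrable_inner_square_integrable[OF c Y] by simp
    show "AE \<omega> in M. norm (f (Y \<omega>)) \<le> norm (f 0 + g 0 \<bullet> Y \<omega> + C / 2 * (norm (Y \<omega>))\<^sup>2)"
    proof (rule AE_I2)
      fix \<omega>
      show "norm (f (Y \<omega>)) \<le> norm (f 0 + g 0 \<bullet> Y \<omega> + C / 2 * (norm (Y \<omega>))\<^sup>2)"
        using descent[of 0 "Y \<omega>"] nonneg[of "Y \<omega>"] by simp
    qed
  qed measurable
qed

lemma integrable_energy:
  assumes "prob_space M" "square_integrable M Y" "square_integrable M Z"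
  shows "integrable M (\<lambda>\<omega>. energy a b (Y \<omega>) (Z \<omega>))"
proof -
  have "integrable M (\<lambda>\<omega>. g (Y \<omega>) \<bullet> Z \<omega>)"
    using prob_space.integrable_inner_square_integrable[OF assms(1) square_integrable_g[OF assms(1,2)] assms(3)] .
  then show ?thesis
    unfolding energy_def using integrable_f[OF assms(1,2)] assms(3)
    by (auto simp: square_integrable_def)
qed

lemma msgd_square_integrable:
  assumes "prob_space M" "msgd M g \<mu> \<gamma> N X V"
    and noise: "\<And>n. square_integrable M (N (Suc n))"
    and "square_integrable M (X 0)" "square_integrable M (V 0)"
  shows "square_integrable M (X n) \<and> square_integrable M (V n)"
proof (induction n)
  case (Suc n)
  interpret prob_space M by fact
  note sq = square_integrable_add square_integrable_diff square_integrable_scaleR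
    square_integrable_g[OF assms(1)] noise
  \<comment> \<open>The recursion is prescribed only on \<open>space M\<close>, hence the congruence
    lemma.\<close>
  have V: "square_integrable M (V (Suc n))"
    by (rule square_integrable_cong[where Z = "\<lambda>\<omega>. V n \<omega> - (\<gamma> (Suc n) * \<mu>) *\<^sub>R V n \<omega> - \<gamma> (Suc n) *\<^sub>R g (X n \<omega>)
                      + \<gamma> (Suc n) *\<^sub>R N (Suc n) \<omega>"])
      (use Suc assms(2) in \<open>auto simp: msgd_def intro!: sq\<close>)
  moreover have "square_integrable M (X (Suc n))"
    by (rule square_integrable_cong[where Z = "\<lambda>\<omega>. X n \<omega> + \<gamma> (Suc n) *\<^sub>R V (Suc n) \<omega>"])
      (use Suc V assms(2) in \<open>auto simp: msgd_def intro!: sq\<close>)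
  ultimately show ?case by simp
qed (use assms in simp)

text \<open>The pathwise inequality is integrated over the event. The linear noise term drops out
  because its factor, cut off by the event, is \<open>F n\<close>-measurable; the quadratic one
  contributes a nonpositive amount by the conditional variance bound. The energy at
  \<open>Suc n\<close> is paired with the event at \<open>n\<close>, which is known at time
  \<open>n\<close>.\<close>

lemma expected_energy_step:
  assumes F: "filtered_prob_space M F" and \<D>: "\<D> \<in> sets borel"
    and ab: "b\<^sup>2 * C < a" "b \<ge> 0" and sq: "square_integrable M (X n)" "square_integrable M (V n)"
      "square_integrable M (X (Suc n))" "square_integrable M (V (Suc n))"
    and N: "L2_martingale_differences M F N"
    and adapted: "adapted F X" "adapted F V"
    and msgd: "msgd M g \<mu> \<gamma> N X V"
    and h: "h = \<gamma> (Suc n)" "h > 0"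
    and noise: "AE \<omega> in M. \<omega> \<in> stay_event M X \<D> n \<longrightarrow>
                real_cond_exp M (F n) (\<lambda>\<omega>. (norm (N (Suc n) \<omega>))\<^sup>2) \<omega> \<le> \<sigma> * f (X n \<omega>)"
    and q: "q = a * C * h\<^sup>2 / 2 + b * C * h + 1 / 2"
    and step: "\<And>x v d w v'. \<lbrakk>x \<in> \<D>; w = v - (h * \<mu>) *\<^sub>R v - h *\<^sub>R g x; v' = w + h *\<^sub>R d\<rbrakk> \<Longrightarrow>
      energy a b (x + h *\<^sub>R v') v' \<le> \<rho> * energy a b x v
      + (((a * h + b) * h) *\<^sub>R g x + (2 * q * h) *\<^sub>R w) \<bullet> d
      + q * h\<^sup>2 * ((norm d)\<^sup>2 - \<sigma> * f x)"
  shows "(\<integral>\<omega>. indicat_real (stay_event M X \<D> n) \<omega> * energy a b (X (Suc n) \<omega>) (V (Suc n) \<omega>) \<partial>M)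
    \<le> \<rho> * (\<integral>\<omega>. indicat_real (stay_event M X \<D> n) \<omega> * energy a b (X n \<omega>) (V n \<omega>) \<partial>M)"
proof -
  have M: "prob_space M" and filt: "filtration (space M) F" and sub: "subalgebra M (F n)"
    using F by (auto simp: filtered_prob_space_def)
  interpret prob_space M by fact
  define A where "A = stay_event M X \<D> n"
  have AF: "A \<in> sets (F n)" unfolding A_def by (rule stay_event_measurable[OF filt adapted(1) \<D>])
  have A: "A \<in> sets M" using AF sub by (auto simp: subalgebra_def)
  let ?N = "N (Suc n)"
  have sqN: "square_integrable M ?N" using N by (auto simp: L2_martingale_differences_def)
  \<comment> \<open>\<open>w\<close> is the velocity update without noise and \<open>u\<close> the
    factor of the noise in the energy estimate; both are functions of \<open>X n\<close> and
    \<open>V n\<close>.\<close>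
  define w where "w \<omega> = V n \<omega> - (h * \<mu>) *\<^sub>R V n \<omega> - h *\<^sub>R g (X n \<omega>)" for \<omega>
  define u where "u \<omega> = ((a * h + b) * h) *\<^sub>R g (X n \<omega>) + (2 * q * h) *\<^sub>R w \<omega>" for \<omega>
  have sqw: "square_integrable M w"
    unfolding w_def by (intro square_integrable_diff square_integrable_scaleR square_integrable_g M sq)
  have squ: "square_integrable M u"
    unfolding u_def by (intro square_integrable_add square_integrable_scaleR square_integrable_g M sq sqw)
  have [measurable]: "g \<in> borel_measurable borel"
    using continuous_g by (rule borel_measurable_continuous_onI)
  have [measurable]: "X n \<in> borel_measurable (F n)" "V n \<in> borel_measurable (F n)"
    using adapted by (auto simp: adapted_def)
  note [measurable] = AF
  have "(\<lambda>\<omega>. indicat_real A \<omega> *\<^sub>R u \<omega>) \<in> borel_measurable (F n)"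
    unfolding u_def w_def by measurable
  then have centered: "(\<integral>\<omega>. (indicat_real A \<omega> *\<^sub>R u \<omega>) \<bullet> ?N \<omega> \<partial>M) = 0"
    using N by (intro integral_inner_centered[OF sub] square_integrable_indicator squ A sqN)
      (auto simp: L2_martingale_differences_def)
  let ?E = "\<lambda>n \<omega>. energy a b (X n \<omega>) (V n \<omega>)"
  have intN: "integrable M (\<lambda>\<omega>. (norm (?N \<omega>))\<^sup>2)" using sqN by (simp add: square_integrable_def)
  have intf: "integrable M (\<lambda>\<omega>. \<sigma> * f (X n \<omega>))" using integrable_f[OF M sq(1)] by simp
  have le: "(\<integral>\<omega>. indicat_real A \<omega> * (norm (?N \<omega>))\<^sup>2 \<partial>M) \<le> (\<integral>\<omega>. indicat_real A \<omega> * (\<sigma> * f (X n \<omega>)) \<partial>M)"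
    by (rule integral_indicator_le_cond_exp[OF sub AF intN intf]) (use noise in \<open>simp add: A_def\<close>)
  have ints: "integrable M (\<lambda>\<omega>. indicat_real A \<omega> * ?E (Suc n) \<omega>)"
    "integrable M (\<lambda>\<omega>. indicat_real A \<omega> * ?E n \<omega>)"
    "integrable M (\<lambda>\<omega>. indicat_real A \<omega> * (norm (?N \<omega>))\<^sup>2)"
    "integrable M (\<lambda>\<omega>. indicat_real A \<omega> * (\<sigma> * f (X n \<omega>)))"
    "integrable M (\<lambda>\<omega>. (indicat_real A \<omega> *\<^sub>R u \<omega>) \<bullet> ?N \<omega>)"
    using integrable_mult_indicator[OF A integrable_energy[OF M sq(1,2)]]
      integrable_mult_indicator[OF A integrable_energy[OF M sq(3,4)]]
      integrable_mult_indicator[OF A intN] integrable_mult_indicator[OF A intf]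
      integrable_inner_square_integrable[OF square_integrable_indicator[OF squ A] sqN]
    by simp_all
  \<comment> \<open>The sign of \<open>q\<close> is what allows the quadratic noise term to be
    discarded at the end.\<close>
  have "0 \<le> b\<^sup>2 * C" using C_nonneg by simp
  then have "a \<ge> 0" using ab(1) by linarith
  then have q0: "q \<ge> 0" using ab(2) C_nonneg h(2) by (simp add: q)
  have "(\<integral>\<omega>. indicat_real A \<omega> * ?E (Suc n) \<omega> \<partial>M) \<le>
      (\<integral>\<omega>. \<rho> * (indicat_real A \<omega> * ?E n \<omega>) + (indicat_real A \<omega> *\<^sub>R u \<omega>) \<bullet> ?N \<omega>
        + q * h\<^sup>2 * (indicat_real A \<omega> * (norm (?N \<omega>))\<^sup>2 - indicat_real A \<omega> * (\<sigma> * f (X n \<omega>))) \<partial>M)"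
  proof (rule integral_mono)
    fix \<omega> assume \<omega>: "\<omega> \<in> space M"
    show "indicat_real A \<omega> * ?E (Suc n) \<omega> \<le> \<rho> * (indicat_real A \<omega> * ?E n \<omega>)
        + (indicat_real A \<omega> *\<^sub>R u \<omega>) \<bullet> ?N \<omega>
        + q * h\<^sup>2 * (indicat_real A \<omega> * (norm (?N \<omega>))\<^sup>2 - indicat_real A \<omega> * (\<sigma> * f (X n \<omega>)))"
    proof (cases "\<omega> \<in> A")
      case True
      then have x: "X n \<omega> \<in> \<D>" by (simp add: A_def stay_event_def)
      have v: "V (Suc n) \<omega> = w \<omega> + h *\<^sub>R ?N \<omega>"
        and x': "X (Suc n) \<omega> = X n \<omega> + h *\<^sub>R V (Suc n) \<omega>"
        using msgd \<omega> by (auto simp: msgd_def w_def h)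
      show ?thesis
        using step[OF x w_def v] True by (simp add: x' u_def)
    qed simp
  qed (intro Bochner_Integration.integrable_add Bochner_Integration.integrable_diff
      integrable_mult_right ints)+
  also have "\<dots> = \<rho> * (\<integral>\<omega>. indicat_real A \<omega> * ?E n \<omega> \<partial>M) + 0
      + q * h\<^sup>2 * ((\<integral>\<omega>. indicat_real A \<omega> * (norm (?N \<omega>))\<^sup>2 \<partial>M)
        - (\<integral>\<omega>. indicat_real A \<omega> * (\<sigma> * f (X n \<omega>)) \<partial>M))"
    using ints centered by (subst Bochner_Integration.integral_add Bochner_Integration.integral_diff
        integral_mult_right; (intro Bochner_Integration.integrable_add Bochner_Integration.integrable_diff
      integrable_mult_right ints)?)+ simp
  also have "\<dots> \<le> \<rho> * (\<integral>\<omega>. indicat_real A \<omega> * ?E n \<omega> \<partial>M)"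
    using le q0 by (simp add: mult_nonneg_nonpos)
  finally show ?thesis unfolding A_def .
qed

text \<open>For small \<open>h\<close> the factor \<open>1 - m * h + K * h\<^sup>2\<close> is at
  most \<open>exp (- (m - \<epsilon>) * h)\<close>, and these factors multiply along the trajectory.
  The constants are chosen before step sizes, noise and trajectory, and depend on the process only
  through its initial values.\<close>

lemma msgd_expectation_decay:
  assumes F: "filtered_prob_space M F" and \<D>: "\<D> \<in> sets borel"
    and X0: "square_integrable M X0" and V0: "square_integrable M V0"
    and ab: "b\<^sup>2 * C < a" "b \<ge> 0" and \<epsilon>: "\<epsilon> > 0"
    and drift: "\<And>x v. x \<in> \<D> \<Longrightarrow>
      (a - b * \<mu> - 1) * (g x \<bullet> v) + (b * C - \<mu>) * (norm v)\<^sup>2 - b * (norm (g x))\<^sup>2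
       \<le> - m * energy a b x v"
  obtains B h\<^sub>0 where "B \<ge> 0" "h\<^sub>0 > 0" "\<And>\<gamma> N X V n.
     \<lbrakk>\<forall>n\<ge>1. 0 < \<gamma> n \<and> \<gamma> n \<le> h\<^sub>0; L2_martingale_differences M F N; adapted F X; adapted F V;
      X 0 = X0; V 0 = V0; msgd M g \<mu> \<gamma> N X V;
      \<forall>n. AE \<omega> in M. \<omega> \<in> stay_event M X \<D> n \<longrightarrow>
        real_cond_exp M (F n) (\<lambda>\<omega>. (norm (N (Suc n) \<omega>))\<^sup>2) \<omega> \<le> \<sigma> * f (X n \<omega>);
      1 \<le> n\<rbrakk> \<Longrightarrow>
     prob_space.expectation M
         (\<lambda>\<omega>. indicat_real (stay_event M X \<D> (n - 1)) \<omega> * f (X n \<omega>))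
       \<le> B * exp (- (m - \<epsilon>) * (\<Sum>i=1..n. \<gamma> i))"
proof -
  have M: "prob_space M" and filt: "filtration (space M) F" and sub: "\<And>n. subalgebra M (F n)"
    using F by (auto simp: filtered_prob_space_def)
  interpret prob_space M by fact
  obtain c where c: "c > 0" "\<And>x v. c * (f x + (norm v)\<^sup>2) \<le> energy a b x v"
    using energy_coercive[OF ab(1)] by blast
  have energy_nonneg: "0 \<le> energy a b x v" for x v
  proof -
    have "0 \<le> c * (f x + (norm v)\<^sup>2)" using c(1) nonneg by simp
    then show ?thesis using c(2)[of x v] by linarith
  qed
  have f_le: "f x \<le> energy a b x v / c" for x v
  proof -
    have "c * f x \<le> energy a b x v" using c(2)[of x v] c(1) by (simp add: distrib_left)
        (smt (verit) mult_nonneg_nonneg zero_le_power2)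
    then show ?thesis using c(1) by (simp add: field_simps)
  qed
  obtain K where K: "K \<ge> 0" "\<And>h x v d w v' q.
    \<lbrakk>0 < h; h \<le> 1; w = v - (h * \<mu>) *\<^sub>R v - h *\<^sub>R g x; v' = w + h *\<^sub>R d;
     q = a * C * h\<^sup>2 / 2 + b * C * h + 1 / 2;
     (a - b * \<mu> - 1) * (g x \<bullet> v) + (b * C - \<mu>) * (norm v)\<^sup>2 - b * (norm (g x))\<^sup>2
       \<le> - m * energy a b x v\<rbrakk> \<Longrightarrow>
    energy a b (x + h *\<^sub>R v') v' \<le> (1 - m * h + K * h\<^sup>2) * energy a b x v
      + (((a * h + b) * h) *\<^sub>R g x + (2 * q * h) *\<^sub>R w) \<bullet> d
      + q * h\<^sup>2 * ((norm d)\<^sup>2 - \<sigma> * f x)"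
    using energy_step[OF ab, of \<mu> m \<sigma>] by blast
  \<comment> \<open>Ensures \<open>K * h\<^sup>2 \<le> \<epsilon> * h\<close> for steps up to
    \<open>h0\<close>; \<open>K + 1\<close> avoids division by zero, and the bound 1 is required by
    \<open>energy_step\<close>.\<close>
  define h0 where "h0 = min 1 (\<epsilon> / (K + 1))"
  have h0: "h0 > 0" "h0 \<le> 1" "K * h0 \<le> \<epsilon>"
  proof -
    show "h0 > 0" "h0 \<le> 1" using K(1) \<epsilon> by (auto simp: h0_def)
    have "K * h0 \<le> K * (\<epsilon> / (K + 1))" using K(1) by (intro mult_left_mono) (auto simp: h0_def)
    also have "\<dots> \<le> \<epsilon>" using K(1) \<epsilon> by (simp add: field_simps)
    finally show "K * h0 \<le> \<epsilon>" .
  qed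
  \<comment> \<open>The mean initial energy, divided by the constant with which coercivity bounds
    \<open>f\<close>.\<close>
  define B where "B = (\<integral>\<omega>. energy a b (X0 \<omega>) (V0 \<omega>) \<partial>M) / c"
  have B: "B \<ge> 0" unfolding B_def using c(1) energy_nonneg by (intro divide_nonneg_pos Bochner_Integration.integral_nonneg) auto
  show thesis
  proof (rule that[OF B h0(1)])
    fix \<gamma> N X V and n :: nat
    assume \<gamma>: "\<forall>n\<ge>1. 0 < \<gamma> n \<and> \<gamma> n \<le> h0"
      and N: "L2_martingale_differences M F N"
      and adapted: "adapted F X" "adapted F V" and init: "X 0 = X0" "V 0 = V0"
      and msgd: "msgd M g \<mu> \<gamma> N X V"
      and noise: "\<forall>n. AE \<omega> in M. \<omega> \<in> stay_event M X \<D> n \<longrightarrow>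
        real_cond_exp M (F n) (\<lambda>\<omega>. (norm (N (Suc n) \<omega>))\<^sup>2) \<omega> \<le> \<sigma> * f (X n \<omega>)"
      and n: "1 \<le> n"
    have sq: "square_integrable M (X n)" "square_integrable M (V n)" for n
      using msgd_square_integrable[OF M msgd, of n] N X0 V0
      by (auto simp: init L2_martingale_differences_def)
    let ?E = "\<lambda>n \<omega>. energy a b (X n \<omega>) (V n \<omega>)"
    let ?A = "stay_event M X \<D>"
    have A: "?A n \<in> sets M" for n
      using stay_event_measurable[OF filt adapted(1) \<D>, of n] sub[of n] by (auto simp: subalgebra_def)
    have int_E: "integrable M (?E n)" for n by (rule integrable_energy[OF M sq])
    have int_AE: "integrable M (\<lambda>\<omega>. indicat_real (?A k) \<omega> * ?E n \<omega>)" for k n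
      using integrable_mult_indicator[OF A int_E] by simp
    have step: "(\<integral>\<omega>. indicat_real (?A n) \<omega> * ?E (Suc n) \<omega> \<partial>M)
        \<le> exp (- (m - \<epsilon>) * \<gamma> (Suc n)) * (\<integral>\<omega>. indicat_real (?A n) \<omega> * ?E n \<omega> \<partial>M)" for n
    proof -
      define h where "h = \<gamma> (Suc n)"
      have h: "h > 0" "h \<le> h0" "h \<le> 1" using \<gamma> h0 by (auto simp: h_def intro: order_trans)
      have "(\<integral>\<omega>. indicat_real (?A n) \<omega> * ?E (Suc n) \<omega> \<partial>M)
          \<le> (1 - m * h + K * h\<^sup>2) * (\<integral>\<omega>. indicat_real (?A n) \<omega> * ?E n \<omega> \<partial>M)"
        by (rule expected_energy_step[OF F \<D> ab sq sq N adapted msgd h_def h(1) noise[rule_format] refl])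
          (rule K(2)[OF h(1,3) _ _ refl drift])
      also have "\<dots> \<le> exp (- (m - \<epsilon>) * h) * (\<integral>\<omega>. indicat_real (?A n) \<omega> * ?E n \<omega> \<partial>M)"
      proof (rule mult_right_mono)
        have "K * h * h \<le> \<epsilon> * h"
          using h h0(3) mult_left_mono[OF h(2) K(1)] by (intro mult_right_mono) auto
        then have "1 - m * h + K * h\<^sup>2 \<le> 1 + (- (m - \<epsilon>) * h)"
          by (simp add: power2_eq_square algebra_simps)
        also have "\<dots> \<le> exp (- (m - \<epsilon>) * h)" by (rule exp_ge_add_one_self)
        finally show "1 - m * h + K * h\<^sup>2 \<le> exp (- (m - \<epsilon>) * h)" .
        show "0 \<le> (\<integral>\<omega>. indicat_real (?A n) \<omega> * ?E n \<omega> \<partial>M)"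
          by (intro Bochner_Integration.integral_nonneg) (simp add: energy_nonneg)
      qed
      finally show ?thesis unfolding h_def .
    qed
    have decay: "(\<integral>\<omega>. indicat_real (?A n) \<omega> * ?E (Suc n) \<omega> \<partial>M)
        \<le> exp (- (m - \<epsilon>) * (\<Sum>i=1..Suc n. \<gamma> i)) * (\<integral>\<omega>. ?E 0 \<omega> \<partial>M)" for n
    proof (induction n)
      case 0
      have "(\<integral>\<omega>. indicat_real (?A 0) \<omega> * ?E 0 \<omega> \<partial>M) \<le> (\<integral>\<omega>. ?E 0 \<omega> \<partial>M)"
        by (rule integral_mono[OF int_AE int_E]) (auto simp: indicator_def energy_nonneg)
      then show ?case
        using order_trans[OF step[of 0] mult_left_mono] by simp
    next
      case (Suc n)
      \<comment> \<open>The events decrease in \<open>n\<close> and the energy is nonnegative, so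
        passing to the next event only lowers the mean and the one-step bounds can be
        chained.\<close>
      have "(\<integral>\<omega>. indicat_real (?A (Suc n)) \<omega> * ?E (Suc n) \<omega> \<partial>M)
          \<le> (\<integral>\<omega>. indicat_real (?A n) \<omega> * ?E (Suc n) \<omega> \<partial>M)"
        by (rule integral_mono[OF int_AE int_AE])
          (auto simp: indicator_def energy_nonneg stay_event_def)
      then have "(\<integral>\<omega>. indicat_real (?A (Suc n)) \<omega> * ?E (Suc (Suc n)) \<omega> \<partial>M)
          \<le> exp (- (m - \<epsilon>) * \<gamma> (Suc (Suc n))) *
            (exp (- (m - \<epsilon>) * (\<Sum>i=1..Suc n. \<gamma> i)) * (\<integral>\<omega>. ?E 0 \<omega> \<partial>M))"
        using Suc.IH by (intro order_trans[OF step[of "Suc n"]] mult_left_mono) auto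
      also have "\<dots> = exp (- (m - \<epsilon>) * (\<Sum>i=1..Suc (Suc n). \<gamma> i)) * (\<integral>\<omega>. ?E 0 \<omega> \<partial>M)"
      proof -
        have "(\<Sum>i=1..Suc (Suc n). \<gamma> i) = (\<Sum>i=1..Suc n. \<gamma> i) + \<gamma> (Suc (Suc n))" by simp
        then show ?thesis by (simp only: distrib_left exp_add mult_ac)
      qed
      finally show ?case .
    qed
    obtain k where k: "n = Suc k" using n by (cases n) auto
    have "(\<integral>\<omega>. indicat_real (?A (n - 1)) \<omega> * f (X n \<omega>) \<partial>M)
        \<le> (\<integral>\<omega>. (indicat_real (?A k) \<omega> * ?E (Suc k) \<omega>) / c \<partial>M)"
      unfolding k
    proof (rule integral_mono)
      show "integrable M (\<lambda>\<omega>. indicat_real (?A (Suc k - 1)) \<omega> * f (X (Suc k) \<omega>))"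
        using integrable_mult_indicator[OF A integrable_f[OF M sq(1)]] by simp
      show "integrable M (\<lambda>\<omega>. (indicat_real (?A k) \<omega> * ?E (Suc k) \<omega>) / c)"
        using int_AE by simp
    qed (auto simp: indicator_def f_le)
    also have "\<dots> = (\<integral>\<omega>. indicat_real (?A k) \<omega> * ?E (Suc k) \<omega> \<partial>M) / c" by simp
    also have "\<dots> \<le> (exp (- (m - \<epsilon>) * (\<Sum>i=1..Suc k. \<gamma> i)) * (\<integral>\<omega>. ?E 0 \<omega> \<partial>M)) / c"
      using c(1) by (intro divide_right_mono decay) auto
    also have "\<dots> = B * exp (- (m - \<epsilon>) * (\<Sum>i=1..n. \<gamma> i))"
      by (simp add: B_def k init)
    finally show "(\<integral>\<omega>. indicat_real (?A (n - 1)) \<omega> * f (X n \<omega>) \<partial>M)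
        \<le> B * exp (- (m - \<epsilon>) * (\<Sum>i=1..n. \<gamma> i))" .
  qed
qed

end

section \<open>The admissible frictions satisfy the coefficient conditions\<close>

lemma friction_conditions_below:
  fixes C L \<mu> m :: real
  assumes L: "L > 0" "L \<le> C" "8 * C < 9 * L" and \<mu>: "\<mu> > 0" and m: "m = sqrt (2 * L)"
    and mem: "\<mu> \<in> {1 / sqrt 8 * (5 - sqrt (9 - 8 * (C / L))) * sqrt L ..
                   1 / sqrt 8 * (5 + sqrt (9 - 8 * (C / L))) * sqrt L}"
  shows "m * \<mu> < 2 * L + m\<^sup>2"
    and "C * m \<le> (\<mu> - m / 2) * (2 * L + m\<^sup>2 - m * \<mu>)"
    and "m\<^sup>2 * C \<le> 2 * L * (2 * L + m\<^sup>2 - m * \<mu>)"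
proof -
  have m0: "m > 0" and m2: "m\<^sup>2 = 2 * L" using L by (auto simp: m)
  define d where "d = sqrt (9 - 8 * (C / L))"
  have CL: "C / L < 9 / 8" using L by (simp add: field_simps)
  then have d2: "d\<^sup>2 * L = 9 * L - 8 * C" using L by (simp add: d_def algebra_simps)
  have s8: "sqrt 8 = 2 * sqrt (2::real)" using real_sqrt_mult[of 4 2] by simp
  have sm: "sqrt 8 * sqrt L = 2 * m" by (simp add: s8 m real_sqrt_mult)
  \<comment> \<open>Membership in the interval is a bound on the distance to its midpoint; squaring
    it removes the root \<open>d\<close> and leads to the quadratic inequality
    \<open>quad\<close>.\<close>
  have "\<bar>sqrt 8 * \<mu> - 5 * sqrt L\<bar> \<le> d * sqrt L"
    using mem unfolding d_def[symmetric] by (simp add: field_simps abs_le_iff)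
  then have "(sqrt 8 * \<mu> - 5 * sqrt L)\<^sup>2 \<le> (d * sqrt L)\<^sup>2"
    by (metis abs_ge_zero power2_abs power_mono)
  moreover have "(d * sqrt L)\<^sup>2 = 9 * L - 8 * C" using L d2 by (simp add: power_mult_distrib)
  moreover have "(sqrt 8 * \<mu> - 5 * sqrt L)\<^sup>2 = 8 * \<mu>\<^sup>2 - 10 * \<mu> * (sqrt 8 * sqrt L) + 25 * L"
    using L by (simp add: power2_diff power_mult_distrib)
  ultimately have quad: "2 * \<mu>\<^sup>2 - 5 * (m * \<mu>) + 4 * L + 2 * C \<le> 0"
    unfolding sm by (simp add: mult_ac)
  define y where "y = m * \<mu>"
  have y2: "y\<^sup>2 = 2 * L * \<mu>\<^sup>2" by (simp add: y_def power_mult_distrib m2)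
  have "L * (2 * \<mu>\<^sup>2 - 5 * y + 4 * L + 2 * C) \<le> 0"
    using quad L by (simp add: y_def mult_nonneg_nonpos)
  then have quad_y: "y\<^sup>2 - 5 * L * y + 4 * L\<^sup>2 + 2 * C * L \<le> 0"
    unfolding y2 by (simp add: power2_eq_square algebra_simps)
  \<comment> \<open>With \<open>m\<^sup>2 = 2 * L\<close> this is equivalent to the potential
    condition. Expanded around \<open>4 * L - C\<close>, the quadratic in \<open>y\<close> would be
    positive for any larger \<open>y\<close>, contradicting \<open>quad_y\<close>.\<close>
  have y: "y \<le> 4 * L - C"
  proof (rule ccontr)
    assume "\<not> y \<le> 4 * L - C"
    then have z: "y - (4 * L - C) > 0" by simp
    have "y\<^sup>2 - 5 * L * y + 4 * L\<^sup>2 + 2 * C * L =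
        (y - (4 * L - C))\<^sup>2 + (3 * L - 2 * C) * (y - (4 * L - C)) + C * (C - L)"
      by (simp add: power2_eq_square algebra_simps)
    moreover have "0 < (3 * L - 2 * C) * (y - (4 * L - C))"
      using z L by (intro mult_pos_pos) linarith+
    moreover have "0 \<le> C * (C - L)" using L by (intro mult_nonneg_nonneg) auto
    ultimately show False using quad_y zero_le_power2[of "y - (4 * L - C)"] by linarith
  qed
  show "m * \<mu> < 2 * L + m\<^sup>2" using y L by (simp add: m2 y_def)
  show "m\<^sup>2 * C \<le> 2 * L * (2 * L + m\<^sup>2 - m * \<mu>)" using y L by (simp add: m2 y_def)
  \<comment> \<open>For this rate the kinetic condition is a rearrangement of \<open>quad\<close>
    times \<open>m / 2\<close>, which explains the interval for \<mu>.\<close>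
  have "C * m \<le> m * (5 / 2 * (m * \<mu>) - \<mu>\<^sup>2 - 2 * L)"
    using quad m0 by (simp add: mult.commute[of C])
  also have "\<dots> = (\<mu> - m / 2) * (2 * L + m\<^sup>2 - m * \<mu>)"
    unfolding m2[symmetric] by (simp add: power2_eq_square field_simps)
  finally show "C * m \<le> (\<mu> - m / 2) * (2 * L + m\<^sup>2 - m * \<mu>)" .
qed

text \<open>In terms of \<open>k = sqrt C\<close> and \<open>l = sqrt (C - L)\<close> all quantities
  are polynomial. The kinetic condition then holds with equality, and the potential one reduces to
  \<open>k \<le> k + l\<close>.\<close>

lemma friction_conditions_above:
  fixes C L \<mu> m :: real
  assumes L: "L > 0" "9 * L \<le> 8 * C"
    and \<mu>: "\<mu> = 2 * sqrt C - sqrt (C - L)" and m: "m = 2 * (sqrt C - sqrt (C - L))"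
  shows "m > 0" and "m\<^sup>2 \<le> 2 * L"
    and "m * \<mu> < 2 * L + m\<^sup>2"
    and "C * m \<le> (\<mu> - m / 2) * (2 * L + m\<^sup>2 - m * \<mu>)"
    and "m\<^sup>2 * C \<le> 2 * L * (2 * L + m\<^sup>2 - m * \<mu>)"
proof -
  define k where "k = sqrt C"
  define l where "l = sqrt (C - L)"
  have k2: "C = k\<^sup>2" and l2: "L = k\<^sup>2 - l\<^sup>2" using L by (auto simp: k_def l_def)
  have kl: "0 \<le> l" "l < k" using L by (auto simp: k_def l_def)
  \<comment> \<open>This is the threshold 9/8 for the ratio of \<open>C\<close> to \<open>L\<close>,
    and it is equivalent to \<open>m\<^sup>2 \<le> 2 * L\<close>.\<close>
  have k3: "k \<le> 3 * l"
  proof (rule power2_le_imp_le)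
    show "k\<^sup>2 \<le> (3 * l)\<^sup>2" using L by (simp add: k2 l2 power_mult_distrib)
  qed (use kl in simp)
  have \<mu>': "\<mu> = 2 * k - l" and m': "m = 2 * (k - l)" by (auto simp: \<mu> m k_def l_def)
  have Q: "2 * L + m\<^sup>2 - m * \<mu> = 2 * k * (k - l)"
    by (simp add: \<mu>' m' l2 power2_eq_square algebra_simps)
  have Lf: "L = (k - l) * (k + l)" by (simp add: l2 power2_eq_square algebra_simps)
  show "m > 0" using kl by (simp add: m')
  show "m\<^sup>2 \<le> 2 * L"
  proof -
    have "m\<^sup>2 = 2 * (k - l) * (2 * (k - l))" by (simp add: m' power2_eq_square)
    also have "\<dots> \<le> 2 * (k - l) * (k + l)" using kl k3 by (intro mult_left_mono) auto
    also have "\<dots> = 2 * L" by (simp only: Lf mult.assoc)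
    finally show ?thesis .
  qed
  have "0 < 2 * k * (k - l)" using kl by simp
  then show "m * \<mu> < 2 * L + m\<^sup>2" using Q by linarith
  show "C * m \<le> (\<mu> - m / 2) * (2 * L + m\<^sup>2 - m * \<mu>)"
    unfolding Q by (simp add: \<mu>' m' k2 power2_eq_square field_simps)
  have "m\<^sup>2 * C = 4 * (k - l)\<^sup>2 * k * k" by (simp add: m' k2 power2_eq_square algebra_simps)
  also have "\<dots> \<le> 4 * (k - l)\<^sup>2 * k * (k + l)" using kl by (intro mult_left_mono) auto
  also have "\<dots> = 2 * L * (2 * k * (k - l))" by (simp add: Lf power2_eq_square)
  finally show "m\<^sup>2 * C \<le> 2 * L * (2 * L + m\<^sup>2 - m * \<mu>)" unfolding Q .
qed

lemma (in smooth_nonneg) lyapunov_parameters: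
  assumes L: "L > 0" and PL: "\<And>x. x \<in> \<D> \<Longrightarrow> 2 * L * f x \<le> (norm (g x))\<^sup>2"
    and \<mu>: "\<mu> > 0" and \<epsilon>: "\<epsilon> > 0"
    and mem: "\<mu> \<in> (if C / L < 9/8
               then {1 / sqrt 8 * (5 - sqrt (9 - 8 * (C / L))) * sqrt L ..
                     1 / sqrt 8 * (5 + sqrt (9 - 8 * (C / L))) * sqrt L}
               else {(2 * sqrt (C / L) - sqrt (C / L - 1)) * sqrt L})"
    and m: "m = (if C / L < 9/8 then sqrt (2 * L) else 2 * (sqrt (C / L) - sqrt (C / L - 1)) * sqrt L)"
  obtains m' a b where "m - \<epsilon> \<le> m'" "b\<^sup>2 * C < a" "b \<ge> 0"
    "\<And>x v. x \<in> \<D> \<Longrightarrow>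
      (a - b * \<mu> - 1) * (g x \<bullet> v) + (b * C - \<mu>) * (norm v)\<^sup>2 - b * (norm (g x))\<^sup>2
       \<le> - m' * energy a b x v"
proof (cases "C < L")
  case True
  have zero: "f x = 0 \<and> g x = 0" if "x \<in> \<D>" for x
  proof -
    have "2 * L * f x \<le> 2 * C * f x" using PL[OF that] norm_g_sq_le[of x] by linarith
    then have "0 \<le> (C - L) * f x" by (simp add: algebra_simps)
    then have "f x = 0" using True nonneg[of x] by (simp add: zero_le_mult_iff)
    then show ?thesis using norm_g_sq_le[of x] by simp
  qed
  have CL: "C / L < 9 / 8" "0 \<le> C / L" using True L C_nonneg by (auto simp: field_simps)
  \<comment> \<open>Hence the lower endpoint of the interval is at least half of
    \<open>sqrt (2 * L)\<close>, so the damping rate \<open>2 * \<mu>\<close> of the kinetic energy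
    reaches \<open>m\<close>.\<close>
  have "sqrt (9 - 8 * (C / L)) \<le> 3" using CL by (intro real_le_lsqrt) auto
  then have "1 / sqrt 8 * 2 * sqrt L \<le> 1 / sqrt 8 * (5 - sqrt (9 - 8 * (C / L))) * sqrt L"
    using L by (intro mult_right_mono mult_left_mono) auto
  also have "\<dots> \<le> \<mu>" using mem CL by simp
  finally have "4 * sqrt L / sqrt 8 \<le> 2 * \<mu>" by simp
  moreover have "4 * sqrt L / sqrt 8 = sqrt (2 * L)"
  proof -
    have "sqrt 8 = 2 * sqrt (2::real)" using real_sqrt_mult[of 4 2] by simp
    then have "4 * sqrt L / sqrt 8 = 2 / sqrt 2 * sqrt L" by simp
    then show ?thesis by (simp add: real_div_sqrt real_sqrt_mult)
  qed
  ultimately have "m \<le> 2 * \<mu>" using CL m by simp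
  then show thesis
    by (intro that[where m' = "2 * \<mu>" and a = 1 and b = 0])
      (use \<epsilon> zero in \<open>auto simp: energy_def\<close>)
next
  case False
  have "m > 0 \<and> m\<^sup>2 \<le> 2 * L \<and> m * \<mu> < 2 * L + m\<^sup>2 \<and>
    C * m \<le> (\<mu> - m / 2) * (2 * L + m\<^sup>2 - m * \<mu>) \<and>
    m\<^sup>2 * C \<le> 2 * L * (2 * L + m\<^sup>2 - m * \<mu>)"
  proof (cases "C / L < 9 / 8")
    case True
    then have "8 * C < 9 * L" using L by (simp add: field_simps)
    then show ?thesis
      using friction_conditions_below[of L C \<mu> m] L False \<mu> mem m True by simp
  next
    case False
    then have C: "9 * L \<le> 8 * C" using L by (simp add: field_simps)
    have "C / L - 1 = (C - L) / L" using L by (simp add: field_simps)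
    then have s: "sqrt (C / L) * sqrt L = sqrt C" "sqrt (C / L - 1) * sqrt L = sqrt (C - L)"
      using L by (simp_all add: real_sqrt_divide)
    have "\<mu> = 2 * sqrt C - sqrt (C - L)"
      using mem False by (simp add: left_diff_distrib s mult.assoc)
    moreover have "m = 2 * (sqrt C - sqrt (C - L))"
      using m False by (simp add: mult.assoc left_diff_distrib s)
    ultimately show ?thesis using friction_conditions_above[OF L C] by simp
  qed
  then obtain m' a b where p: "m - \<epsilon> \<le> m'" "b\<^sup>2 * C < a" "b \<ge> 0"
    "a - b * \<mu> - 1 = - m' * b" "b * C - \<mu> \<le> - m' / 2" "2 * L * b = m' * a"
    using friction_parameters[of L C \<mu> m \<epsilon>] L False \<mu> \<epsilon> by (metis not_less)
  show thesis
  proof (rule that[OF p(1-3)])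
    fix x v :: 'b assume "x \<in> \<D>"
    \<comment> \<open>The relation \<open>2 * L * b = m' * a\<close> lets the gradient dissipation
      pay for the decay of the potential part.\<close>
    have "m' * a * f x = b * (2 * L * f x)" unfolding p(6)[symmetric] by simp
    also have "\<dots> \<le> b * (norm (g x))\<^sup>2" by (intro mult_left_mono PL p(3)) fact
    finally have "m' * a * f x \<le> b * (norm (g x))\<^sup>2" .
    moreover have "(b * C - \<mu>) * (norm v)\<^sup>2 \<le> - m' / 2 * (norm v)\<^sup>2"
      by (intro mult_right_mono p(5)) simp
    ultimately show "(a - b * \<mu> - 1) * (g x \<bullet> v) + (b * C - \<mu>) * (norm v)\<^sup>2 - b * (norm (g x))\<^sup>2
       \<le> - m' * energy a b x v"
      unfolding p(4) energy_def by (simp add: algebra_simps)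
  qed
qed

theorem theorem3p2:
  fixes f :: "real ^ 'd \<Rightarrow> real" and grad_f :: "real ^ 'd \<Rightarrow> real ^ 'd"
    and M :: "'a measure" and F :: "nat \<Rightarrow> 'a measure"
    and X0 V0 :: "'a \<Rightarrow> real ^ 'd"
    and \<D> :: "(real ^ 'd) set"
    and C\<^sub>L L \<sigma> \<kappa> \<mu> m :: real
  assumes "\<forall>x. GDERIV f x :> grad_f x"
    and "C\<^sub>L \<ge> 0" and "C\<^sub>L-lipschitz_on UNIV grad_f"
    and "bdd_below (range f)" and "(INF x. f x) = 0"
    and "filtered_prob_space M F"
    and "X0 \<in> borel_measurable (F 0)" and "square_integrable M X0"
    and "V0 \<in> borel_measurable (F 0)" and "square_integrable M V0"
    and "L > 0" and "\<sigma> \<ge> 0"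
    and "open \<D>" and "\<forall>x\<in>\<D>. (norm (grad_f x))\<^sup>2 \<ge> 2 * L * f x"
    and "\<kappa> = C\<^sub>L / L"
    and "\<mu> > 0"
    and "\<mu> \<in> (if \<kappa> < 9/8
               then {1 / sqrt 8 * (5 - sqrt (9 - 8 * \<kappa>)) * sqrt L ..
                     1 / sqrt 8 * (5 + sqrt (9 - 8 * \<kappa>)) * sqrt L}
               else {(2 * sqrt \<kappa> - sqrt (\<kappa> - 1)) * sqrt L})"
    and "m = (if \<kappa> < 9/8 then sqrt (2 * L) else 2 * (sqrt \<kappa> - sqrt (\<kappa> - 1)) * sqrt L)"
  shows "\<forall>\<epsilon>>0. \<exists>C\<ge>0. \<exists>\<gamma>bar>0.
           \<forall>(\<gamma> :: nat \<Rightarrow> real) (N :: nat \<Rightarrow> 'a \<Rightarrow> real ^ 'd)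
             (X :: nat \<Rightarrow> 'a \<Rightarrow> real ^ 'd) (V :: nat \<Rightarrow> 'a \<Rightarrow> real ^ 'd).
             (\<forall>n\<ge>1. \<gamma> n > 0) \<longrightarrow>
             L2_martingale_differences M F N \<longrightarrow>
             adapted F X \<longrightarrow> adapted F V \<longrightarrow>
             X 0 = X0 \<longrightarrow> V 0 = V0 \<longrightarrow>
             msgd M grad_f \<mu> \<gamma> N X V \<longrightarrow>
             (\<forall>n. AE \<omega> in M. \<omega> \<in> stay_event M X \<D> n \<longrightarrow>
                real_cond_exp M (F n) (\<lambda>\<omega>. (norm (N (Suc n) \<omega>))\<^sup>2) \<omega> \<le> \<sigma> * f (X n \<omega>)) \<longrightarrow>
             (SUP n\<in>{1..}. ereal (\<gamma> n)) \<le> ereal \<gamma>bar \<longrightarrow>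
             (\<forall>n\<ge>1. prob_space.expectation M
                       (\<lambda>\<omega>. indicat_real (stay_event M X \<D> (n - 1)) \<omega> * f (X n \<omega>))
                     \<le> C * exp (- (m - \<epsilon>) * (\<Sum>i=1..n. \<gamma> i)))"
proof (intro allI impI)
  fix \<epsilon> :: real assume \<epsilon>: "\<epsilon> > 0"
  have nonneg: "0 \<le> f x" for x
    using cINF_lower[OF assms(4), of x] assms(5) by simp
  interpret smooth_nonneg f grad_f C\<^sub>L
    using assms(1,3) nonneg by unfold_locales auto
  \<comment> \<open>One half of \<epsilon> pays for the lowered Lyapunov rate \<open>m'\<close>, the
    other for the discretization error.\<close>
  have \<epsilon>2: "\<epsilon> / 2 > 0" using \<epsilon> by simp
  obtain m' a b where p: "m - \<epsilon> / 2 \<le> m'" "b\<^sup>2 * C\<^sub>L < a" "b \<ge> 0"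
    and drift: "\<And>x v. x \<in> \<D> \<Longrightarrow>
      (a - b * \<mu> - 1) * (grad_f x \<bullet> v) + (b * C\<^sub>L - \<mu>) * (norm v)\<^sup>2 - b * (norm (grad_f x))\<^sup>2
       \<le> - m' * energy a b x v"
    by (rule lyapunov_parameters[where \<D> = \<D>, OF assms(11) assms(14)[rule_format] assms(16) \<epsilon>2
          assms(17)[unfolded assms(15)] assms(18)[unfolded assms(15)]],
        assumption, rule that)
  have \<D>: "\<D> \<in> sets borel" using assms(13) by simp
  obtain B h0 where B: "B \<ge> 0" and h0: "h0 > 0" and decay: "\<And>\<gamma> N X V n.
     \<lbrakk>\<forall>n\<ge>1. 0 < \<gamma> n \<and> \<gamma> n \<le> h0; L2_martingale_differences M F N; adapted F X; adapted F V;
      X 0 = X0; V 0 = V0; msgd M grad_f \<mu> \<gamma> N X V;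
      \<forall>n. AE \<omega> in M. \<omega> \<in> stay_event M X \<D> n \<longrightarrow>
        real_cond_exp M (F n) (\<lambda>\<omega>. (norm (N (Suc n) \<omega>))\<^sup>2) \<omega> \<le> \<sigma> * f (X n \<omega>);
      1 \<le> n\<rbrakk> \<Longrightarrow>
     prob_space.expectation M
         (\<lambda>\<omega>. indicat_real (stay_event M X \<D> (n - 1)) \<omega> * f (X n \<omega>))
       \<le> B * exp (- (m' - \<epsilon> / 2) * (\<Sum>i=1..n. \<gamma> i))"
    by (rule msgd_expectation_decay[OF assms(6) \<D> assms(8,10) p(2,3) \<epsilon>2 drift],
        assumption, rule that)
  show "\<exists>C\<ge>0. \<exists>\<gamma>bar>0.
           \<forall>(\<gamma> :: nat \<Rightarrow> real) (N :: nat \<Rightarrow> 'a \<Rightarrow> real ^ 'd)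
             (X :: nat \<Rightarrow> 'a \<Rightarrow> real ^ 'd) (V :: nat \<Rightarrow> 'a \<Rightarrow> real ^ 'd).
             (\<forall>n\<ge>1. \<gamma> n > 0) \<longrightarrow>
             L2_martingale_differences M F N \<longrightarrow>
             adapted F X \<longrightarrow> adapted F V \<longrightarrow>
             X 0 = X0 \<longrightarrow> V 0 = V0 \<longrightarrow>
             msgd M grad_f \<mu> \<gamma> N X V \<longrightarrow>
             (\<forall>n. AE \<omega> in M. \<omega> \<in> stay_event M X \<D> n \<longrightarrow>
                real_cond_exp M (F n) (\<lambda>\<omega>. (norm (N (Suc n) \<omega>))\<^sup>2) \<omega> \<le> \<sigma> * f (X n \<omega>)) \<longrightarrow>
             (SUP n\<in>{1..}. ereal (\<gamma> n)) \<le> ereal \<gamma>bar \<longrightarrow>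
             (\<forall>n\<ge>1. prob_space.expectation M
                       (\<lambda>\<omega>. indicat_real (stay_event M X \<D> (n - 1)) \<omega> * f (X n \<omega>))
                     \<le> C * exp (- (m - \<epsilon>) * (\<Sum>i=1..n. \<gamma> i)))"
  proof (rule exI[of _ B], rule conjI[OF B], rule exI[of _ h0], rule conjI[OF h0], intro allI impI)
    fix \<gamma> N X V and n :: nat
    assume \<gamma>: "\<forall>n\<ge>1. \<gamma> n > 0" and sup: "(SUP n\<in>{1..}. ereal (\<gamma> n)) \<le> ereal h0" and n: "1 \<le> n"
      and process: "L2_martingale_differences M F N" "adapted F X" "adapted F V"
        "X 0 = X0" "V 0 = V0" "msgd M grad_f \<mu> \<gamma> N X V"
        "\<forall>n. AE \<omega> in M. \<omega> \<in> stay_event M X \<D> n \<longrightarrow>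
          real_cond_exp M (F n) (\<lambda>\<omega>. (norm (N (Suc n) \<omega>))\<^sup>2) \<omega> \<le> \<sigma> * f (X n \<omega>)"
    have "ereal (\<gamma> k) \<le> ereal h0" if "1 \<le> k" for k
      using that by (intro order_trans[OF SUP_upper sup]) simp
    then have "\<forall>n\<ge>1. 0 < \<gamma> n \<and> \<gamma> n \<le> h0" using \<gamma> by simp
    from decay[OF this process n]
    have "prob_space.expectation M (\<lambda>\<omega>. indicat_real (stay_event M X \<D> (n - 1)) \<omega> * f (X n \<omega>))
        \<le> B * exp (- (m' - \<epsilon> / 2) * (\<Sum>i=1..n. \<gamma> i))" .
    also have "\<dots> \<le> B * exp (- (m - \<epsilon>) * (\<Sum>i=1..n. \<gamma> i))"
    proof (rule mult_left_mono[OF _ B])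
      \<comment> \<open>Since the elapsed time is nonnegative, the comparison
        \<open>m - \<epsilon> \<le> m' - \<epsilon> / 2\<close> carries over to the
        exponents.\<close>
      have "0 \<le> (\<Sum>i=1..n. \<gamma> i)" using \<gamma> by (intro sum_nonneg) (auto intro: less_imp_le)
      then have "- (m' - \<epsilon> / 2) * (\<Sum>i=1..n. \<gamma> i) \<le> - (m - \<epsilon>) * (\<Sum>i=1..n. \<gamma> i)"
        using p(1) by (intro mult_right_mono) linarith+
      then show "exp (- (m' - \<epsilon> / 2) * (\<Sum>i=1..n. \<gamma> i)) \<le> exp (- (m - \<epsilon>) * (\<Sum>i=1..n. \<gamma> i))"
        by simp
    qed
    finally show "prob_space.expectation M
          (\<lambda>\<omega>. indicat_real (stay_event M X \<D> (n - 1)) \<omega> * f (X n \<omega>))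
        \<le> B * exp (- (m - \<epsilon>) * (\<Sum>i=1..n. \<gamma> i))" .
  qed
qed

end
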